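(* Let $(W,S)$ be a Coxeter system, $\mathbb{F}$ a field, and $\mathbf{q}=(q_s\in\mathbb{F}: s\in S)$. Let $G$ be the underlying graph of the Coxeter diagram of $(W,S)$ and let $\mathcal{I}(G)$ be the set of all independent sets in $G$. If $\mathcal{H}(\mathbf{q})$ is collapse-free and commutative, then $\dim_{\mathbb{F}}\mathcal{H}(\mathbf{q})=|\mathcal{I}(G)|$. In particular, if moreover $(W,S)$ is of type $A_n$, then the dimension of $\mathcal{H}(\mathbf{q})$ is the Fibonacci number $F_{n+2}$.
   Context: A Coxeter system $(W,S)$ has $S$ finite and $W=\langle S: s^2=1,\ (sts\cdots)_{m_{st}}=(tst\cdots)_{m_{st}}\ \forall s\ne t\in S\rangle$, where $m_{st}=m_{ts}\in\{2,3,\ldots\}\cup\{\infty\}$ and $(aba\cdots)_m$ denotes the alternating product of $m$ factors starting with $a$; no relation is imposed between $s$ and $t$ if $m_{st}=\infty$ (and $\infty$ is not odd). The Coxeter diagram is the edge-weighted graph with vertex set $S$ and an edge of weight $m_{st}$ between $s\neq t$ whenever $m_{st}\ge 3$. Type $A_n$ means the diagram is a path with $n$ vertices, all edges having weight $3$. The Hecke algebra $\mathcal{H}(\mathbf{q})=\mathcal{H}_S(\mathbf{q})$ of $(W,S)$ with independent parameters $\mathbf{q}=(q_s\in\mathbb{F}:s\in S)$ is the unital associative $\mathbb{F}$-algebra generated by $\{T_s:s\in S\}$ subject to the quadratic relations $(T_s-1)(T_s+q_s)=0$ for all $s\in S$ and the braid relations $(T_sT_tT_s\cdots)_{m_{st}}=(T_tT_sT_t\cdots)_{m_{st}}$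 for all $s\neq t$ in $S$ (none if $m_{st}=\infty$). $\mathcal{H}(\mathbf{q})$ is called collapse-free if, whenever $m_{st}$ is odd and $q_s\neq q_t$, at least one of $q_s$ and $q_t$ is $0$. An independent set of $G$ is a set of pairwise non-adjacent vertices (the empty set included). Fibonacci numbers: $F_0=0$, $F_1=1$, $F_n=F_{n-1}+F_{n-2}$ for $n\ge2$. *)

theory Defs
  imports
    "HOL-Algebra.Algebra"
    "HOL-Library.Poly_Mapping"
    "HOL-Library.Extended_Nat"
    "HOL-Number_Theory.Fib"
begin

fun alternating :: "'a \<Rightarrow> 'a \<Rightarrow> nat \<Rightarrow> 'a list" where
  "alternating a b 0 = []"
| "alternating a b (Suc k) = a # alternating b a k"


section \<open>Coxeter systems\<close>

definition coxeter_relations :: "'s set \<Rightarrow> ('s \<Rightarrow> 's \<Rightarrow> enat) \<Rightarrow> ('s list \<times> 's list) set" where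
  "coxeter_relations S m =
     {([s, s], []) | s. s \<in> S} \<union>
     {(alternating s t k, alternating t s k) | s t k. s \<in> S \<and> t \<in> S \<and> s \<noteq> t \<and> m s t = enat k}"

definition word_congruence :: "'s set \<Rightarrow> ('s list \<times> 's list) set \<Rightarrow> ('s list \<times> 's list) set" where
  "word_congruence S R =
     (let r = {(x @ u @ y, x @ v @ y) | x u v y. x \<in> lists S \<and> y \<in> lists S \<and> (u, v) \<in> R}
      in (r \<union> r\<inverse>)\<^sup>*)"

text \<open>
  \<open>(W, S)\<close> is a Coxeter system with Coxeter matrix \<open>m\<close>: \<open>W\<close> is generated by \<open>S\<close>, and two words in
  \<open>S\<close> represent the same element of \<open>W\<close> exactly when the defining relations identify them.
  Formal inverses of letters are not needed in the presentation because the relations include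
  \<open>s\<^sup>2 = 1\<close>.  The values \<open>m s s\<close> are irrelevant and left unconstrained.
\<close>

definition coxeter_system :: "('s, 'b) monoid_scheme \<Rightarrow> 's set \<Rightarrow> ('s \<Rightarrow> 's \<Rightarrow> enat) \<Rightarrow> bool" where
  "coxeter_system W S m \<longleftrightarrow>
     group W \<and> finite S \<and> S \<subseteq> carrier W \<and>
     (\<forall>s\<in>S. \<forall>t\<in>S. s \<noteq> t \<longrightarrow> m s t = m t s \<and> 2 \<le> m s t) \<and>
     generate W S = carrier W \<and>
     (\<forall>u\<in>lists S. \<forall>v\<in>lists S.
        foldr (\<otimes>\<^bsub>W\<^esub>) u \<one>\<^bsub>W\<^esub> = foldr (\<otimes>\<^bsub>W\<^esub>) v \<one>\<^bsub>W\<^esub> \<longleftrightarrow>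
        (u, v) \<in> word_congruence S (coxeter_relations S m))"

definition diagram_edges :: "'s set \<Rightarrow> ('s \<Rightarrow> 's \<Rightarrow> enat) \<Rightarrow> 's set set" where
  "diagram_edges S m = {{s, t} | s t. s \<in> S \<and> t \<in> S \<and> s \<noteq> t \<and> 3 \<le> m s t}"

definition independent_sets :: "'s set \<Rightarrow> 's set set \<Rightarrow> 's set set" where
  "independent_sets V E = {I. I \<subseteq> V \<and> pairwise (\<lambda>s t. {s, t} \<notin> E) I}"

definition type_A :: "nat \<Rightarrow> 's set \<Rightarrow> ('s \<Rightarrow> 's \<Rightarrow> enat) \<Rightarrow> bool" where
  "type_A n S m \<longleftrightarrow>
     (\<exists>v. bij_betw v {1..n} S \<and>
        diagram_edges S m = {{v i, v (Suc i)} | i. 1 \<le> i \<and> i < n}) \<and>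
     (\<forall>s\<in>S. \<forall>t\<in>S. {s, t} \<in> diagram_edges S m \<longrightarrow> m s t = 3)"


section \<open>Hecke algebras with independent parameters\<close>

text \<open>
  With concatenation as the addition on lists, the convolution product on
  \<^typ>\<open>'s list \<Rightarrow>\<^sub>0 'f\<close> is the multiplication of noncommutative polynomials.
\<close>

instantiation list :: (type) monoid_add
begin

definition zero_list :: "'a list" where "zero_list = []"

definition plus_list :: "'a list \<Rightarrow> 'a list \<Rightarrow> 'a list" where "plus_list = (@)"

instance
  by standard (simp_all add: zero_list_def plus_list_def)

end

definition free_algebra :: "'s set \<Rightarrow> ('s list \<Rightarrow>\<^sub>0 'f::field) ring" where
  "free_algebra S =
     \<lparr>carrier = {p. Poly_Mapping.keys p \<subseteq> lists S}, monoid.mult = (*), one = 1, ring.zero = 0, ring.add = (+)\<rparr>"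

lemma ring_free_algebra: "ring (free_algebra S :: ('s list \<Rightarrow>\<^sub>0 'f::field) ring)"
proof (rule ringI)
  show "abelian_group (free_algebra S :: ('s list \<Rightarrow>\<^sub>0 'f) ring)"
  proof (rule abelian_groupI)
    fix x :: "'s list \<Rightarrow>\<^sub>0 'f"
    assume "x \<in> carrier (free_algebra S)"
    then show "\<exists>y\<in>carrier (free_algebra S). y \<oplus>\<^bsub>free_algebra S\<^esub> x = \<zero>\<^bsub>free_algebra S\<^esub>"
      by (intro bexI[of _ "- x"]) (auto simp: free_algebra_def)
  qed (use Poly_Mapping.keys_add in \<open>fastforce simp: free_algebra_def add_ac\<close>)+
  show "monoid (free_algebra S :: ('s list \<Rightarrow>\<^sub>0 'f) ring)"
  proof (rule monoidI)
    fix x y :: "'s list \<Rightarrow>\<^sub>0 'f"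
    assume "x \<in> carrier (free_algebra S)" "y \<in> carrier (free_algebra S)"
    then have "Poly_Mapping.keys (x * y) \<subseteq> lists S"
      using keys_mult[of x y] by (fastforce simp: free_algebra_def plus_list_def)
    then show "x \<otimes>\<^bsub>free_algebra S\<^esub> y \<in> carrier (free_algebra S)"
      by (simp add: free_algebra_def)
  qed (auto simp: free_algebra_def mult.assoc zero_list_def)
qed (auto simp: free_algebra_def algebra_simps)

definition gen :: "'s \<Rightarrow> 's list \<Rightarrow>\<^sub>0 'f::field" where
  "gen s = Poly_Mapping.single [s] 1"

definition const :: "'f \<Rightarrow> 's list \<Rightarrow>\<^sub>0 'f::field" where
  "const c = Poly_Mapping.single [] c"

definition hecke_relators ::
    "'s set \<Rightarrow> ('s \<Rightarrow> 's \<Rightarrow> enat) \<Rightarrow> ('s \<Rightarrow> 'f::field) \<Rightarrow> ('s list \<Rightarrow>\<^sub>0 'f) set" where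
  "hecke_relators S m q =
     {(gen s - 1) * (gen s + const (q s)) | s. s \<in> S} \<union>
     {prod_list (alternating (gen s) (gen t) k) - prod_list (alternating (gen t) (gen s) k)
        | s t k. s \<in> S \<and> t \<in> S \<and> s \<noteq> t \<and> m s t = enat k}"

text \<open>\<^const>\<open>genideal\<close> generates two-sided ideals.\<close>

definition hecke_ideal ::
    "'s set \<Rightarrow> ('s \<Rightarrow> 's \<Rightarrow> enat) \<Rightarrow> ('s \<Rightarrow> 'f::field) \<Rightarrow> ('s list \<Rightarrow>\<^sub>0 'f) set" where
  "hecke_ideal S m q = Idl\<^bsub>free_algebra S\<^esub> (hecke_relators S m q)"

definition hecke_algebra ::
    "'s set \<Rightarrow> ('s \<Rightarrow> 's \<Rightarrow> enat) \<Rightarrow> ('s \<Rightarrow> 'f::field) \<Rightarrow> ('s list \<Rightarrow>\<^sub>0 'f) set ring" where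
  "hecke_algebra S m q = free_algebra S Quot hecke_ideal S m q"

text \<open>
  The image of the ground field under the structure map \<open>c \<mapsto> c \<cdot> 1\<close>.  The algebra is never
  zero (sending all generators to \<open>1\<close> respects the relations), so this is a copy of the field.
\<close>

definition hecke_scalars ::
    "'s set \<Rightarrow> ('s \<Rightarrow> 's \<Rightarrow> enat) \<Rightarrow> ('s \<Rightarrow> 'f::field) \<Rightarrow> ('s list \<Rightarrow>\<^sub>0 'f) set set" where
  "hecke_scalars S m q = range (\<lambda>c. hecke_ideal S m q +>\<^bsub>free_algebra S\<^esub> const c)"

text \<open>The algebra is finite-dimensional over the ground field, of dimension \<open>d\<close>.\<close>

definition hecke_dimension ::
    "'s set \<Rightarrow> ('s \<Rightarrow> 's \<Rightarrow> enat) \<Rightarrow> ('s \<Rightarrow> 'f::field) \<Rightarrow> nat \<Rightarrow> bool" where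
  "hecke_dimension S m q d \<longleftrightarrow>
     ring.dimension (hecke_algebra S m q) d (hecke_scalars S m q) (carrier (hecke_algebra S m q))"

definition collapse_free :: "'s set \<Rightarrow> ('s \<Rightarrow> 's \<Rightarrow> enat) \<Rightarrow> ('s \<Rightarrow> 'f::field) \<Rightarrow> bool" where
  "collapse_free S m q \<longleftrightarrow>
     (\<forall>s\<in>S. \<forall>t\<in>S. \<forall>k. s \<noteq> t \<and> m s t = enat k \<and> odd k \<and> q s \<noteq> q t \<longrightarrow> q s = 0 \<or> q t = 0)"

end

theory Submission
  imports Defs "HOL-Algebra.Algebraic_Closure_Type" "HOL-Library.Function_Algebras"
begin

text \<open>
  Commutativity forces every edge \<open>s\<close>, \<open>t\<close> of the diagram to have odd weight, with exactly one of the two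
  parameters equal to zero.  For each edge violating this there is a module on which \<open>T\<^sub>s\<close> and \<open>T\<^sub>t\<close> do
  not commute.  If both parameters are nonzero, it is a deformed reflection (Burau) representation over
  the algebraic closure: \<open>T\<^sub>u v = v - f\<^sub>u(v) e\<^sub>u\<close> with \<open>f\<^sub>u(e\<^sub>u) = 1 + q\<^sub>u\<close>, the braid relation between \<open>u\<close>
  and \<open>w\<close> being a polynomial condition on \<open>f\<^sub>u(e\<^sub>w) f\<^sub>w(e\<^sub>u)\<close>, while generators with parameter zero act
  by \<open>0\<close>.  If \<open>q\<^sub>t = 0\<close>, the same space is used with a suitable rank one projection for \<open>T\<^sub>t\<close>.

  Along the remaining edges, with \<open>q\<^sub>s = 0\<close> say, \<open>T\<^sub>s T\<^sub>t = T\<^sub>s\<close>.  Hence the products over independent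
  sets span, and an explicit action on functions of subsets of \<open>S\<close> shows that they are linearly
  independent.
\<close>

section \<open>Alternating products of two shears\<close>

text \<open>No embedding of the rank two Hecke algebra of \<open>s\<close>, \<open>t\<close> is
  available a priori, so noncommutativity along an edge must be exhibited on a module for all of
  \<open>S\<close>. The collapse-free condition makes this possible: letters of nonzero parameter
  joined by an odd weight have equal parameters, so a deformed reflection representation exists on
  them, and a letter of parameter 0 may act by 0 because its quadratic relation is only idempotence.
  The matrix of the values \<open>f_u(e_w)\<close> may be degenerate, and the product fixed by a
  braid relation may even be 0; an additional basis vector, on which the functionals have prescribed
  values, keeps the commutator visible. Spanning rests on the asymmetry of an edge: one letter is
  idempotent, the other invertible. Once letters commute, an odd braid relation only compares
  exponents, and cancelling the invertible letter leaves the absorption rule.\<close>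

fun recpoly :: "'a::comm_ring_1 \<Rightarrow> 'a \<Rightarrow> nat \<Rightarrow> 'a Polynomial.poly" where
  "recpoly b d 0 = 1"
| "recpoly b d (Suc 0) = [:b, 1:]"
| "recpoly b d (Suc (Suc n)) = [:0, 1:] * recpoly b d (Suc n) - Polynomial.smult d (recpoly b d n)"

text \<open>For \<open>b = 0\<close> these are Dickson polynomials of the second kind, that is,
  rescaled Chebyshev polynomials. The degree matters because a positive one provides a root over an
  algebraically closed field.\<close>

lemma degree_recpoly:
  fixes b d :: "'a::idom"
  shows "Polynomial.degree (recpoly b d n) = n"
proof (induction n rule: induct_nat_012)
  case (ge2 n)
  from ge2(2) have "recpoly b d (Suc n) \<noteq> 0" by force
  then have "Polynomial.degree ([:0, 1:] * recpoly b d (Suc n)) = Suc (Suc n)"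
    using ge2(2) by (simp add: degree_pCons_eq)
  moreover have "Polynomial.degree (Polynomial.smult d (recpoly b d n)) \<le> n"
    using degree_smult_le[of d "recpoly b d n"] ge2(1) by simp
  ultimately show ?case
    using degree_add_eq_left[of "- Polynomial.smult d (recpoly b d n)" "[:0, 1:] * recpoly b d (Suc n)"]
    by (simp del: mult_pCons_left)
qed simp_all

lemma recpoly_sequence:
  assumes "D 1 = (x + b) * D 0"
    and "\<And>n. D (Suc (Suc n)) = x * D (Suc n) - d * D n"
  shows "D n = poly (recpoly b d n) x * (D 0 :: 'a::comm_ring_1)"
proof (induction n rule: induct_nat_012)
  case (ge2 n)
  then show ?case using assms(2)[of n] by (simp add: algebra_simps)
qed (use assms(1) in \<open>simp_all add: algebra_simps\<close>)

definition shear :: "(('x \<Rightarrow> 'k) \<Rightarrow> 'k) \<Rightarrow> ('x \<Rightarrow> 'k) \<Rightarrow> ('x \<Rightarrow> 'k) \<Rightarrow> 'x \<Rightarrow> 'k::comm_ring_1" where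
  "shear f e v = (\<lambda>x. v x - f v * e x)"

text \<open>Linearity in the one form that shears produce; additivity and homogeneity are derived
  from it later.\<close>

definition functional :: "(('x \<Rightarrow> 'k) \<Rightarrow> 'k::comm_ring_1) \<Rightarrow> bool" where
  "functional f \<longleftrightarrow> (\<forall>v w c. f (\<lambda>x. v x - c * w x) = f v - c * f w)"

lemma shear_combination:
  assumes "functional f"
  shows "shear f e (\<lambda>x. v x - \<alpha> * e x - \<beta> * d x)
    = (\<lambda>x. v x - (f v - \<alpha> * (f e - 1) - \<beta> * f d) * e x - \<beta> * d x)"
proof -
  have "f (\<lambda>x. v x - \<alpha> * e x - \<beta> * d x) = f v - \<alpha> * f e - \<beta> * f d"
    using assms[unfolded functional_def, rule_format, of "\<lambda>x. v x - \<alpha> * e x" \<beta> d]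
      assms[unfolded functional_def, rule_format, of v \<alpha> e] by simp
  then show ?thesis unfolding shear_def by (simp only:) (simp add: fun_eq_iff algebra_simps)
qed

text \<open>
  On the span of \<open>e\<close> and \<open>d\<close> the product of the two shears has trace
  \<open>x = f d * g e - p - r\<close> and determinant \<open>p * r\<close>; Cayley-Hamilton turns the difference of the two
  alternating products into a second-order recursion in the number of factors.
\<close>

lemma alternating_shears_eq:
  fixes x p r :: "'k::comm_ring_1" and j :: nat
  assumes f: "functional f" "f e = 1 + p" and g: "functional g" "g d = 1 + r"
    and x: "x = f d * g e - p - r"
    and T: "T s = shear f e" "T t = shear g d"
    and k: "k = 2 * j + 2 \<and> poly (recpoly 0 (p * r) j) x = 0
      \<or> k = 2 * j + 1 \<and> p = r \<and> poly (recpoly p (p * p) j) x = 0"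
  shows "foldr T (alternating s t k) v = foldr T (alternating t s k) v"
proof -
  define \<phi> \<psi> where "\<phi> = f v" and "\<psi> = g v"
  \<comment> \<open>\<open>v\<close> minus an alternating product lies in the span of
    \<open>e\<close> and \<open>d\<close>: \<open>A\<close>, \<open>B\<close> are the coefficients
    for the product starting with \<open>s\<close>, and \<open>C\<close>, \<open>D\<close> for the
    one starting with \<open>t\<close>. Prefixing a letter turns one kind of product into the other,
    so all four evolve together.\<close>
  define step where "step = (\<lambda>(\<alpha>, \<beta>, \<gamma>, \<delta>). (\<phi> - p * \<gamma> - f d * \<delta>, \<delta>, \<alpha>, \<psi> - r * \<beta> - g e * \<alpha>))"
  define st where "st n = (step ^^ n) (0, 0, 0, 0)" for n
  define A B C D where "A n = fst (st n)" and "B n = fst (snd (st n))"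
    and "C n = fst (snd (snd (st n)))" and "D n = snd (snd (snd (st n)))" for n
  have 0: "A 0 = 0" "B 0 = 0" "C 0 = 0" "D 0 = 0"
    by (simp_all add: A_def B_def C_def D_def st_def)
  have S: "A (Suc n) = \<phi> - p * C n - f d * D n" "B (Suc n) = D n"
    "C (Suc n) = A n" "D (Suc n) = \<psi> - r * B n - g e * A n" for n
    by (simp_all add: A_def B_def C_def D_def st_def step_def split: prod.splits)
  have fold: "foldr T (alternating s t n) v = (\<lambda>x. v x - A n * e x - B n * d x) \<and>
        foldr T (alternating t s n) v = (\<lambda>x. v x - C n * e x - D n * d x)" for n
  proof (induction n)
    case 0
    show ?case by (simp add: \<open>A 0 = 0\<close> \<open>B 0 = 0\<close> \<open>C 0 = 0\<close> \<open>D 0 = 0\<close>)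
  next
    case (Suc n)
    have "shear g d (\<lambda>x. v x - A n * e x - B n * d x) = (\<lambda>x. v x - C (Suc n) * e x - D (Suc n) * d x)"
      using shear_combination[OF g(1), of d v "B n" "A n" e] g(2)
      by (simp add: S \<psi>_def algebra_simps)
    moreover have "shear f e (\<lambda>x. v x - C n * e x - D n * d x) = (\<lambda>x. v x - A (Suc n) * e x - B (Suc n) * d x)"
      using shear_combination[OF f(1), of e v "C n" "D n" d] f(2)
      by (simp add: S \<phi>_def algebra_simps)
    ultimately show ?case using Suc by (simp add: T)
  qed
  \<comment> \<open>The affine parts of the two recursions contribute the same constant, so the
    differences obey a homogeneous recursion; an index shift by two is one application of both
    shears.\<close>
  define P where "P n = A n - C n" for n
  define Q where "Q n = B n - D n" for n
  have rec: "P (Suc (Suc (Suc (Suc n)))) = x * P (Suc (Suc n)) - p * r * P n"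
    "Q (Suc (Suc (Suc (Suc n)))) = x * Q (Suc (Suc n)) - p * r * Q n" for n
    by (simp_all add: P_def Q_def S x algebra_simps)
  have "P k = 0 \<and> Q k = 0"
    using k
  proof (elim disjE conjE)
    assume k: "k = 2 * j + 2" and root: "poly (recpoly 0 (p * r) j) x = 0"
    \<comment> \<open>This yields \<open>P 4 = x * P 2\<close>, hence the value 0 for
      \<open>b\<close>.\<close>
    have z: "P 0 = 0" "Q 0 = 0" by (simp_all add: P_def Q_def 0)
    have "P (2 * j + 2) = poly (recpoly 0 (p * r) j) x * P (2 * 0 + 2)"
      by (rule recpoly_sequence[where D = "\<lambda>j. P (2 * j + 2)"])
        (simp_all add: rec z numeral_eq_Suc)
    moreover have "Q (2 * j + 2) = poly (recpoly 0 (p * r) j) x * Q (2 * 0 + 2)"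
      by (rule recpoly_sequence[where D = "\<lambda>j. Q (2 * j + 2)"])
        (simp_all add: rec z numeral_eq_Suc)
    ultimately show ?thesis using k root by simp
  next
    assume k: "k = 2 * j + 1" and pr: "p = r" and root: "poly (recpoly p (p * p) j) x = 0"
    \<comment> \<open>Equal parameters give this starting ratio, which is where \<open>b = p\<close>
      comes from.\<close>
    have z: "P 3 = (x + p) * P 1" "Q 3 = (x + p) * Q 1"
      by (simp_all add: P_def Q_def S 0 x pr numeral_eq_Suc algebra_simps)
    have "P (2 * j + 1) = poly (recpoly p (p * p) j) x * P (2 * 0 + 1)"
      by (rule recpoly_sequence[where D = "\<lambda>j. P (2 * j + 1)"])
        (use z pr in \<open>simp_all add: rec numeral_eq_Suc\<close>)
    moreover have "Q (2 * j + 1) = poly (recpoly p (p * p) j) x * Q (2 * 0 + 1)"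
      by (rule recpoly_sequence[where D = "\<lambda>j. Q (2 * j + 1)"])
        (use z pr in \<open>simp_all add: rec numeral_eq_Suc\<close>)
    ultimately show ?thesis using k root by simp
  qed
  then show ?thesis using fold[of k] by (simp add: P_def Q_def)
qed

section \<open>Modules over the Hecke algebra\<close>

abbreviation word :: "'s list \<Rightarrow> 's list \<Rightarrow>\<^sub>0 'f::field" where
  "word w \<equiv> Poly_Mapping.single w 1"

lemma gen_word: "gen s = word [s]"
  by (simp add: gen_def)

lemma word_mult: "word u * word w = word (u @ w)"
  by (simp add: mult_single plus_list_def)

lemma const_mult_word: "const c * word w = Poly_Mapping.single w c"
  by (simp add: const_def mult_single plus_list_def)

lemma prod_list_gen: "prod_list (map gen w) = word w"
  by (induction w) (simp_all add: gen_word word_mult zero_list_def flip: single_one)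

lemma map_alternating: "map f (alternating a b k) = alternating (f a) (f b) k"
  by (induction k arbitrary: a b) simp_all

lemma prod_list_alternating: "prod_list (alternating (gen s) (gen t) k) = word (alternating s t k)"
  by (simp add: prod_list_gen flip: map_alternating)

lemma const_add: "const (a + b) = const a + const b"
  and const_diff: "const (a - b) = const a - const b"
  and const_mult: "const (a * b) = const a * const b"
  and const_0: "const 0 = 0"
  and const_1: "const 1 = 1"
  by (simp_all add: const_def single_add single_diff mult_single plus_list_def zero_list_def flip: single_one)

lemma free_algebra_simps [simp]:
  "p \<in> carrier (free_algebra S) \<longleftrightarrow> Poly_Mapping.keys p \<subseteq> lists S"
  "p \<otimes>\<^bsub>free_algebra S\<^esub> r = p * r" "p \<oplus>\<^bsub>free_algebra S\<^esub> r = p + r"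
  "\<zero>\<^bsub>free_algebra S\<^esub> = 0" "\<one>\<^bsub>free_algebra S\<^esub> = 1"
  by (simp_all add: free_algebra_def)

lemma free_algebra_induct [consumes 1, case_names zero add word]:
  assumes "Poly_Mapping.keys p \<subseteq> lists S"
    and "P 0"
    and "\<And>p r. Poly_Mapping.keys p \<subseteq> lists S \<Longrightarrow> Poly_Mapping.keys r \<subseteq> lists S \<Longrightarrow> P p \<Longrightarrow> P r \<Longrightarrow> P (p + r)"
    and "\<And>w c. w \<in> lists S \<Longrightarrow> P (Poly_Mapping.single w c)"
  shows "P (p :: 's list \<Rightarrow>\<^sub>0 'f::field)"
  using assms(1)
proof (induction p rule: update_induct)
  case (update p w c)
  have eq: "Poly_Mapping.update w c p = p + Poly_Mapping.single w c"
    using update(1) by (intro poly_mapping_eqI)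
      (auto simp: lookup_update lookup_add lookup_single when_def in_keys_iff)
  have "Poly_Mapping.keys (Poly_Mapping.update w c p) = insert w (Poly_Mapping.keys p)"
    using update(1,2) by (auto simp: in_keys_iff lookup_update split: if_splits)
  with update(4) have k: "w \<in> lists S" "Poly_Mapping.keys p \<subseteq> lists S" by auto
  show ?case unfolding eq
    using assms(3)[OF k(2) _ update(3)[OF k(2)] assms(4)[OF k(1)]] k(1) by auto
qed (rule assms(2))

section \<open>Actions of noncommutative polynomials through their letters\<close>

locale word_action = vector_space scale
  for scale :: "'f::field \<Rightarrow> 'v::ab_group_add \<Rightarrow> 'v" (infixr \<open>*s\<close> 75)
  and T :: "'s \<Rightarrow> 'v \<Rightarrow> 'v" +
  assumes T_add: "T s (v + w) = T s v + T s w"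
    and T_scale: "T s (c *s v) = c *s T s v"
begin

definition act :: "('s list \<Rightarrow>\<^sub>0 'f) \<Rightarrow> 'v \<Rightarrow> 'v" where
  "act p v = (\<Sum>w\<in>Poly_Mapping.keys p. Poly_Mapping.lookup p w *s foldr T w v)"

lemma foldr_add: "foldr T w (u + v) = foldr T w u + foldr T w v"
  by (induction w) (simp_all add: T_add)

lemma foldr_scale: "foldr T w (c *s v) = c *s foldr T w v"
  by (induction w) (simp_all add: T_scale)

lemma foldr_0 [simp]: "foldr T w 0 = 0"
  using foldr_scale[of w 0 0] by simp

lemma act_0_right [simp]: "act p 0 = 0"
  by (simp add: act_def)

lemma act_superset:
  assumes "finite K" "Poly_Mapping.keys p \<subseteq> K"
  shows "act p v = (\<Sum>w\<in>K. Poly_Mapping.lookup p w *s foldr T w v)"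
  unfolding act_def using assms by (intro sum.mono_neutral_left) (auto simp: in_keys_iff)

lemma act_add: "act (p + r) v = act p v + act r v"
proof -
  let ?K = "Poly_Mapping.keys p \<union> Poly_Mapping.keys r"
  have "finite ?K" by simp
  then show ?thesis
    using act_superset[of ?K p v] act_superset[of ?K r v] act_superset[of ?K "p + r" v] Poly_Mapping.keys_add[of p r]
    by (simp add: lookup_add scale_left_distrib sum.distrib)
qed

lemma act_0 [simp]: "act 0 v = 0"
  by (simp add: act_def)

lemma act_uminus: "act (- p) v = - act p v"
  by (simp add: act_def sum_negf)

lemma act_diff: "act (p - r) v = act p v - act r v"
  using act_add[of p "- r" v] by (simp add: act_uminus)

lemma act_single: "act (Poly_Mapping.single w c) v = c *s foldr T w v"
  by (simp add: act_def)

lemma act_word [simp]: "act (word w) v = foldr T w v"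
  by (simp add: act_single)

lemma act_add_right: "act p (u + v) = act p u + act p v"
  by (simp add: act_def foldr_add scale_right_distrib sum.distrib)

lemma act_sum: "act (sum p A) v = (\<Sum>x\<in>A. act (p x) v)"
  by (induction A rule: infinite_finite_induct) (simp_all add: act_add)

lemma act_mult: "act (p * r) v = act p (act r v)"
proof -
  have "Poly_Mapping.keys r \<subseteq> lists UNIV" for r :: "'s list \<Rightarrow>\<^sub>0 'f" by simp
  then show ?thesis
  proof (induction p rule: free_algebra_induct)
    case (word u c)
    have "Poly_Mapping.keys r \<subseteq> lists UNIV" by simp
    then show ?case
    proof (induction r rule: free_algebra_induct)
      case (word w d)
      show ?case by (simp add: mult_single act_single plus_list_def foldr_scale)
    qed (simp_all add: act_add act_add_right distrib_left act_single foldr_add scale_right_distrib)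
  qed (simp_all add: act_add distrib_right)
qed

lemma act_one [simp]: "act 1 v = v"
  using act_word[of "[]" v] by (simp add: zero_list_def flip: single_one)

lemma act_const [simp]: "act (const c) v = c *s v"
  by (simp add: const_def act_single)

lemma act_gen [simp]: "act (gen s) v = T s v"
  by (simp add: gen_word)

end

section \<open>The defining ideal and its action on modules\<close>

lemma hecke_relators_carrier:
  "hecke_relators S m (q :: 's \<Rightarrow> 'f::field) \<subseteq> carrier (free_algebra S)"
proof -
  interpret ring "free_algebra S :: ('s list \<Rightarrow>\<^sub>0 'f) ring" by (rule ring_free_algebra)
  have d: "Poly_Mapping.keys (p - r) \<subseteq> lists S"
    if "Poly_Mapping.keys p \<subseteq> lists S" "Poly_Mapping.keys r \<subseteq> lists S" for p r :: "'s list \<Rightarrow>\<^sub>0 'f"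
    using that keys_diff[of p r] by blast
  have a: "set (alternating s t k) \<subseteq> {s, t}" for s t :: 's and k
    by (induction k arbitrary: s t) (simp, fastforce)
  have [simp]: "Poly_Mapping.keys (gen s :: 's list \<Rightarrow>\<^sub>0 'f) \<subseteq> lists S" if "s \<in> S" for s
    using that by (auto simp: gen_def)
  have [simp]: "Poly_Mapping.keys (const c :: 's list \<Rightarrow>\<^sub>0 'f) \<subseteq> lists S" for c
    by (auto simp: const_def)
  have [simp]: "Poly_Mapping.keys (1 :: 's list \<Rightarrow>\<^sub>0 'f) \<subseteq> lists S"
    using one_closed by simp
  have w: "Poly_Mapping.keys (word (alternating s t k) :: 's list \<Rightarrow>\<^sub>0 'f) \<subseteq> lists S" if "s \<in> S" "t \<in> S" for s t k
    using a[of s t k] that by auto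
  have q: "Poly_Mapping.keys ((gen s - 1) * (gen s + const (q s)) :: 's list \<Rightarrow>\<^sub>0 'f) \<subseteq> lists S" if "s \<in> S" for s
    using m_closed[of "gen s - 1" "gen s + const (q s)"] a_closed[of "gen s" "const (q s)"] d[of "gen s" 1] that
    by (simp add: zero_list_def)
  show ?thesis
    unfolding hecke_relators_def prod_list_alternating free_algebra_simps(1) subset_iff[of _ "carrier _"]
    using q d w by blast
qed

lemma hecke_ideal_ideal: "ideal (hecke_ideal S m q) (free_algebra S)"
  unfolding hecke_ideal_def by (rule ring.genideal_ideal[OF ring_free_algebra hecke_relators_carrier])

lemma hecke_relators_in_ideal: "hecke_relators S m q \<subseteq> hecke_ideal S m q"
  unfolding hecke_ideal_def by (rule ring.genideal_self[OF ring_free_algebra hecke_relators_carrier])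

text \<open>The closure conditions on \<open>N\<close> range over all polynomials, not only those in
  letters of \<open>S\<close>, so annihilators can be used without tracking supports; the
  intersection of \<open>N\<close> with the carrier is an ideal containing the relators.\<close>

lemma hecke_ideal_induct:
  assumes "p \<in> hecke_ideal S m q"
    and rel: "\<And>r. r \<in> hecke_relators S m q \<Longrightarrow> r \<in> N"
    and N_zero: "0 \<in> N" and N_add: "\<And>a b. a \<in> N \<Longrightarrow> b \<in> N \<Longrightarrow> a + b \<in> N" and N_uminus: "\<And>a. a \<in> N \<Longrightarrow> - a \<in> N"
    and N_mult: "\<And>a x. a \<in> N \<Longrightarrow> x * a \<in> N" "\<And>a x. a \<in> N \<Longrightarrow> a * x \<in> N"
  shows "p \<in> (N :: ('s list \<Rightarrow>\<^sub>0 'f::field) set)"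
proof -
  let ?R = "free_algebra S :: ('s list \<Rightarrow>\<^sub>0 'f) ring"
  let ?N = "N \<inter> carrier ?R"
  interpret ring ?R by (rule ring_free_algebra)
  have minus: "\<ominus>\<^bsub>?R\<^esub> p = - p" if "p \<in> carrier ?R" for p
    by (rule minus_equality) (use that in simp_all)
  have "ideal ?N ?R"
  proof (rule idealI[OF ring_axioms])
    show "subgroup ?N (add_monoid ?R)"
    proof (rule add.subgroupI)
      fix p assume "p \<in> ?N"
      then show "\<ominus>\<^bsub>?R\<^esub> p \<in> ?N"
        using minus[of p] by (simp add: N_uminus)
    next
      have "0 \<in> ?N" using N_zero by simp
      then show "?N \<noteq> {}" by blast
    next
      fix p r assume "p \<in> ?N" "r \<in> ?N"
      then show "p \<oplus>\<^bsub>?R\<^esub> r \<in> ?N" using a_closed[of p r] by (simp add: N_add)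
    qed auto
  next
    fix p x assume "p \<in> ?N" "x \<in> carrier ?R"
    then show "x \<otimes>\<^bsub>?R\<^esub> p \<in> ?N" "p \<otimes>\<^bsub>?R\<^esub> x \<in> ?N"
      using m_closed[of p x] m_closed[of x p] by (simp_all add: N_mult)
  qed
  then have "hecke_ideal S m q \<subseteq> ?N"
    unfolding hecke_ideal_def using rel hecke_relators_carrier[of S m q]
    by (intro genideal_minimal) auto
  then show ?thesis using assms(1) by blast
qed

locale hecke_module = word_action scale T
  for scale :: "'f::field \<Rightarrow> 'v::ab_group_add \<Rightarrow> 'v" (infixr \<open>*s\<close> 75) and T :: "'s \<Rightarrow> 'v \<Rightarrow> 'v" +
  fixes S :: "'s set" and m :: "'s \<Rightarrow> 's \<Rightarrow> enat" and q :: "'s \<Rightarrow> 'f"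
  assumes quadratic: "s \<in> S \<Longrightarrow> T s (T s v) = T s v - q s *s T s v + q s *s v"
    and braid: "s \<in> S \<Longrightarrow> t \<in> S \<Longrightarrow> s \<noteq> t \<Longrightarrow> m s t = enat k \<Longrightarrow>
      foldr T (alternating s t k) v = foldr T (alternating t s k) v"
begin

lemma act_hecke_ideal:
  assumes "p \<in> hecke_ideal S m q"
  shows "act p v = 0"
proof -
  have "p \<in> {p. \<forall>v. act p v = 0}"
  proof (rule hecke_ideal_induct[OF assms])
    fix r assume "r \<in> hecke_relators S m q"
    then show "r \<in> {p. \<forall>v. act p v = 0}"
      unfolding hecke_relators_def prod_list_alternating
      by (auto simp: act_diff act_mult act_add T_add T_scale quadratic intro: braid)
  qed (auto simp: act_add act_uminus act_mult)
  then show ?thesis by simp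
qed

end

lemma hecke_coset_eq:
  assumes "p \<in> carrier (free_algebra S)" "r \<in> carrier (free_algebra S)"
  shows "hecke_ideal S m q +>\<^bsub>free_algebra S\<^esub> p = hecke_ideal S m q +>\<^bsub>free_algebra S\<^esub> r
    \<longleftrightarrow> p - r \<in> hecke_ideal S m (q :: 's \<Rightarrow> 'f::field)"
proof -
  let ?R = "free_algebra S :: ('s list \<Rightarrow>\<^sub>0 'f) ring"
  interpret ring ?R by (rule ring_free_algebra)
  have "\<ominus>\<^bsub>?R\<^esub> r = - r"
    by (rule minus_equality) (use assms in simp_all)
  then have "p \<ominus>\<^bsub>?R\<^esub> r = p - r" by (simp add: a_minus_def)
  then show ?thesis
    using quotient_eq_iff_same_a_r_cos[OF hecke_ideal_ideal assms, of m q] by metis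
qed

lemma hecke_commutator:
  assumes "cring (hecke_algebra S m q)"
    and p: "p \<in> carrier (free_algebra S)" and r: "r \<in> carrier (free_algebra S)"
  shows "p * r - r * p \<in> hecke_ideal S m (q :: 's \<Rightarrow> 'f::field)"
proof -
  let ?R = "free_algebra S :: ('s list \<Rightarrow>\<^sub>0 'f) ring" and ?I = "hecke_ideal S m q"
  interpret ring ?R by (rule ring_free_algebra)
  interpret ideal ?I ?R by (rule hecke_ideal_ideal)
  interpret h: ring_hom_ring ?R "?R Quot ?I" "(+>\<^bsub>?R\<^esub>) ?I" by (rule rcos_ring_hom_ring)
  interpret H: cring "?R Quot ?I" using assms(1) by (simp add: hecke_algebra_def)
  have "?I +>\<^bsub>?R\<^esub> (p \<otimes>\<^bsub>?R\<^esub> r) = ?I +>\<^bsub>?R\<^esub> (r \<otimes>\<^bsub>?R\<^esub> p)"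
    using H.m_comm[of "?I +>\<^bsub>?R\<^esub> p" "?I +>\<^bsub>?R\<^esub> r"] h.hom_mult[OF p r] h.hom_mult[OF r p] h.hom_closed[OF p] h.hom_closed[OF r]
    by metis
  then show ?thesis
    using hecke_coset_eq[of "p * r" S "r * p" m q] m_closed[OF p r] m_closed[OF r p] by simp
qed

text \<open>The commutator of two generators lies in the defining ideal, which acts by 0. A single
  vector on which two letters fail to commute is therefore a contradiction.\<close>

lemma (in hecke_module) commutative_imp_commuting:
  assumes "cring (hecke_algebra S m q)" "s \<in> S" "t \<in> S"
  shows "T s (T t v) = T t (T s v)"
proof -
  have "gen s * gen t - gen t * gen s \<in> hecke_ideal S m q"
    using assms by (intro hecke_commutator) (auto simp: gen_def)
  from act_hecke_ideal[OF this, of v] show ?thesis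
    by (simp add: act_diff act_mult)
qed

section \<open>Deformed reflection representations\<close>

lemma functional_add: "functional f \<Longrightarrow> f (v + w) = f v + f w"
  and functional_scale: "functional f \<Longrightarrow> f (\<lambda>x. c * v x) = c * f v"
proof -
  assume f: "functional f"
  have 0: "f (\<lambda>x. 0) = 0"
    using f[unfolded functional_def, rule_format, of v 1 v] by simp
  have neg: "f (\<lambda>x. - c * w x) = - c * f w" for c w
    using f[unfolded functional_def, rule_format, of "\<lambda>x. 0" c w] 0 by simp
  show "f (\<lambda>x. c * v x) = c * f v" using neg[of "- c" v] by simp
  show "f (v + w) = f v + f w"
    using f[unfolded functional_def, rule_format, of v "- 1" w] by (simp add: plus_fun_def)
qed

lemma shear_quadratic:
  assumes "functional f" "f e = 1 + p"
  shows "shear f e (shear f e v) x = shear f e v x - p * shear f e v x + p * v x"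
proof -
  have "f (shear f e v) = f v - f v * (1 + p)"
    using assms unfolding shear_def functional_def by metis
  then show ?thesis by (simp add: shear_def algebra_simps)
qed

lemma shear_commute:
  assumes "functional f" "functional g" "f d = 0" "g e = 0"
  shows "shear f e (shear g d v) = shear g d (shear f e v)"
proof -
  have "f (shear g d v) = f v" "g (shear f e v) = g v"
    using assms unfolding shear_def functional_def by (metis diff_zero mult_zero_right)+
  then show ?thesis by (simp add: shear_def fun_eq_iff)
qed

text \<open>Here \<open>c\<close> is the product of the two mixed values of the functionals, and
  \<open>c - p - r\<close> the trace of the product of the shears. For \<open>p = r = 1\<close> over
  the complex numbers the solutions are the classical values 4 cos^2(pi i / k) with 0 < i <
  k/2.\<close>

definition braid_parameter :: "nat \<Rightarrow> 'k::comm_ring_1 \<Rightarrow> 'k \<Rightarrow> 'k \<Rightarrow> bool" where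
  "braid_parameter k p r c \<longleftrightarrow>
     (\<exists>j. k = 2 * j + 2 \<and> poly (recpoly 0 (p * r) j) (c - p - r) = 0
        \<or> k = 2 * j + 1 \<and> p = r \<and> poly (recpoly p (p * p) j) (c - p - r) = 0)"

lemma braid_parameter_commute: "braid_parameter k p r c \<longleftrightarrow> braid_parameter k r p c"
proof -
  have "c - p - r = c - r - p" by (simp add: algebra_simps)
  then show ?thesis unfolding braid_parameter_def by (metis mult.commute)
qed

text \<open>From \<open>3 \<le> k\<close> on the polynomial is nonconstant. For \<open>k = 2\<close>
  it is 1 and has no root, so commuting pairs are handled by vanishing matrix entries
  instead.\<close>

lemma exists_braid_parameter:
  fixes p r :: "'k::alg_closed_field"
  assumes k: "3 \<le> k" "even k \<or> p = r"
  shows "\<exists>c. braid_parameter k p r c"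
proof -
  define b where "b = (if even k then 0 else p)"
  define j where "j = (if even k then (k - 2) div 2 else k div 2)"
  have j: "0 < j" using k(1) unfolding j_def by (cases "even k") (simp_all, presburger+)
  have k': "k = (if even k then 2 * j + 2 else 2 * j + 1)"
    using k(1) by (auto simp: j_def)
  obtain x where x: "poly (recpoly b (p * r) j) x = 0"
    using alg_closed_imp_poly_has_root[of "recpoly b (p * r) j"] j by (auto simp: degree_recpoly)
  have "braid_parameter k p r (x + p + r)"
    unfolding braid_parameter_def using k' k(2) x by (intro exI[of _ j]) (auto simp: b_def split: if_splits)
  then show ?thesis ..
qed

text \<open>
  \<open>a u w\<close> plays the role of \<open>f\<^sub>u(e\<^sub>w)\<close> for deformed reflections \<open>v \<mapsto> v - f\<^sub>u(v) e\<^sub>u\<close>; the braid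
  relations constrain only the products \<open>a u w * a w u\<close>.
\<close>

definition burau_matrix :: "'s set \<Rightarrow> ('s \<Rightarrow> 's \<Rightarrow> enat) \<Rightarrow> ('s \<Rightarrow> 'k) \<Rightarrow> ('s \<Rightarrow> 's \<Rightarrow> 'k::comm_ring_1) \<Rightarrow> bool" where
  "burau_matrix U m q a \<longleftrightarrow>
     (\<forall>u. a u u = 1 + q u) \<and>
     (\<forall>u\<in>U. \<forall>w\<in>U. u \<noteq> w \<longrightarrow>
        (m u w = 2 \<longrightarrow> a u w = 0) \<and>
        (3 \<le> m u w \<longrightarrow> a u w \<noteq> 0 \<or> a w u \<noteq> 0) \<and>
        (\<forall>k\<ge>3. m u w = enat k \<longrightarrow> braid_parameter k (q u) (q w) (a u w * a w u)))"

lemma exists_burau_matrix: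
  fixes q :: "'s \<Rightarrow> 'k::alg_closed_field"
  assumes "finite U"
    and sym: "\<And>u w. u \<in> U \<Longrightarrow> w \<in> U \<Longrightarrow> u \<noteq> w \<Longrightarrow> m u w = m w u"
    and odd: "\<And>u w k. u \<in> U \<Longrightarrow> w \<in> U \<Longrightarrow> u \<noteq> w \<Longrightarrow> m u w = enat k \<Longrightarrow> odd k \<Longrightarrow> q u = q w"
  shows "\<exists>a. burau_matrix U m q a"
proof -
  obtain n :: nat and idx where idx: "inj_on (idx :: 's \<Rightarrow> nat) U"
    using finite_imp_inj_to_nat_seg[OF assms(1)] by blast
  \<comment> \<open>For infinite \<open>m u w\<close> the condition is vacuous and any value
    serves.\<close>
  define c where "c u w = (SOME c. \<forall>k\<ge>3. m u w = enat k \<longrightarrow> braid_parameter k (q u) (q w) c)" for u w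
  have c: "braid_parameter k (q u) (q w) (c u w)"
    if "u \<in> U" "w \<in> U" "u \<noteq> w" "3 \<le> k" "m u w = enat k" for u w k
  proof -
    have "\<exists>c. braid_parameter k (q u) (q w) c"
      using that odd by (intro exists_braid_parameter) blast+
    then have "\<exists>c. \<forall>k\<ge>3. m u w = enat k \<longrightarrow> braid_parameter k (q u) (q w) c"
      using that by auto
    from someI_ex[OF this] show ?thesis using that unfolding c_def by blast
  qed
  \<comment> \<open>The required product is split as 1 times \<open>c\<close> along an arbitrary
    ordering of \<open>U\<close>, so that one entry is nonzero even if \<open>c\<close>
    vanishes.\<close>
  define a where "a u w = (if u = w then 1 + q u else if m u w = 2 then 0
    else if idx u < idx w then 1 else c w u)" for u w
  have 3: "enat k \<noteq> 2" if "3 \<le> k" for k using that by (simp add: numeral_eq_enat)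
  have "burau_matrix U m q a"
    unfolding burau_matrix_def
  proof (intro conjI ballI impI allI)
    fix u w assume u: "u \<in> U" "w \<in> U" "u \<noteq> w"
    then have "idx u \<noteq> idx w" using idx by (auto dest: inj_onD)
    then have lt: "idx u < idx w \<or> idx w < idx u" by linarith
    {
      assume "3 \<le> m u w"
      then have "m u w \<noteq> 2" "m w u \<noteq> 2" using sym[OF u] by (auto simp: numeral_eq_enat)
      then show "a u w \<noteq> 0 \<or> a w u \<noteq> 0" using lt u unfolding a_def by auto
    next
      fix k :: nat assume k: "3 \<le> k" "m u w = enat k"
      then have "m w u = enat k" using sym[OF u] by simp
      then have "m u w \<noteq> 2" "m w u \<noteq> 2" using k 3[OF k(1)] by simp_all
      with lt u have "a u w * a w u = c u w \<or> a u w * a w u = c w u"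
        unfolding a_def by auto
      moreover have "braid_parameter k (q u) (q w) (c u w)" by (rule c[OF u k])
      moreover have "braid_parameter k (q u) (q w) (c w u)"
        using c[of w u k] u k \<open>m w u = enat k\<close> braid_parameter_commute by blast
      ultimately show "braid_parameter k (q u) (q w) (a u w * a w u)" by metis
    }
  qed (auto simp: a_def)
  then show ?thesis by blast
qed

text \<open>\<open>None\<close> is the additional basis vector and \<open>b u\<close> the value of
  the functional on it. No shear changes the coordinate at \<open>None\<close>.\<close>

definition burau_functional :: "('s \<Rightarrow> 's \<Rightarrow> 'k) \<Rightarrow> ('s \<Rightarrow> 'k) \<Rightarrow> 's set \<Rightarrow> 's \<Rightarrow> ('s option \<Rightarrow> 'k) \<Rightarrow> 'k::comm_ring_1" where
  "burau_functional a b S u v = (\<Sum>w\<in>S. a u w * v (Some w)) + b u * v None"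

definition unit_vector :: "'x \<Rightarrow> 'x \<Rightarrow> 'k::comm_ring_1" where
  "unit_vector x y = (if y = x then 1 else 0)"

abbreviation burau :: "('s \<Rightarrow> 's \<Rightarrow> 'k) \<Rightarrow> ('s \<Rightarrow> 'k) \<Rightarrow> 's set \<Rightarrow> 's \<Rightarrow> ('s option \<Rightarrow> 'k) \<Rightarrow> 's option \<Rightarrow> 'k::comm_ring_1" where
  "burau a b S u \<equiv> shear (burau_functional a b S u) (unit_vector (Some u))"

lemma functional_burau: "functional (burau_functional a b S u)"
  by (simp add: functional_def burau_functional_def algebra_simps sum.distrib sum_subtractf sum_distrib_left)

lemma burau_functional_Some [simp]:
  "finite S \<Longrightarrow> w \<in> S \<Longrightarrow> burau_functional a b S u (unit_vector (Some w)) = a u w"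
  by (simp add: burau_functional_def unit_vector_def if_distrib cong: if_cong)

lemma burau_functional_None [simp]: "burau_functional a b S u (unit_vector None) = b u"
  by (simp add: burau_functional_def unit_vector_def)

lemma burau_braid:
  assumes a: "burau_matrix U m q a" and S: "finite S" "U \<subseteq> S" and u: "u \<in> U" "w \<in> U" "u \<noteq> w"
    and k: "m u w = enat k" "2 \<le> k" "m u w = m w u"
    and T: "T u = burau a b S u" "T w = burau a b S w"
  shows "foldr T (alternating u w k) v = foldr T (alternating w u k) v"
proof -
  have uw: "u \<in> S" "w \<in> S" using u S by auto
  show ?thesis
  proof (cases "k = 2")
    case True
    then have "a u w = 0" "a w u = 0"
      using a u k by (auto simp: burau_matrix_def numeral_eq_enat)
    then have "T u (T w v) = T w (T u v)"
      unfolding T using S uw by (intro shear_commute[OF functional_burau functional_burau]) simp_all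
    then show ?thesis
      using True by (simp add: numeral_2_eq_2)
  next
    case False
    then have "braid_parameter k (q u) (q w) (a u w * a w u)"
      using a u k by (auto simp: burau_matrix_def)
    then obtain j where "k = 2 * j + 2 \<and> poly (recpoly 0 (q u * q w) j) (a u w * a w u - q u - q w) = 0
        \<or> k = 2 * j + 1 \<and> q u = q w \<and> poly (recpoly (q u) (q u * q u) j) (a u w * a w u - q u - q w) = 0"
      by (auto simp: braid_parameter_def)
    then show ?thesis
      using a by (intro alternating_shears_eq[OF functional_burau _ functional_burau _ refl T])
        (auto simp: S uw burau_matrix_def)
  qed
qed

text \<open>Settles braid relations of every length from two on, of either parity, in three
  situations: \<open>T t\<close> is zero, \<open>T s\<close> is the identity and \<open>T t\<close>
  idempotent, or \<open>T t\<close> genuinely absorbs \<open>T s\<close>.\<close>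

lemma alternating_absorb:
  assumes "2 \<le> k" and "\<And>v. T s (T t v) = T t v" "\<And>v. T t (T s v) = T t v" "\<And>v. T t (T t v) = T t v"
  shows "foldr T (alternating s t k) v = T t v" "foldr T (alternating t s k) v = T t v"
proof -
  have *: "foldr T (alternating s t (n + 2)) v = T t v \<and> foldr T (alternating t s (n + 2)) v = T t v" for n
    by (induction n) (simp_all add: assms)
  obtain n where "k = n + 2" using assms(1) by (metis le_add_diff_inverse2)
  with * show "foldr T (alternating s t k) v = T t v" "foldr T (alternating t s k) v = T t v"
    by blast+
qed

text \<open>Scalars act through the embedding into the algebraic closure: roots of
  \<open>recpoly\<close> become available while the space remains a module over the original
  field.\<close>

definition ac_scale :: "'f::field \<Rightarrow> ('x \<Rightarrow> 'f alg_closure) \<Rightarrow> 'x \<Rightarrow> 'f alg_closure" where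
  "ac_scale c v = (\<lambda>x. to_ac c * v x)"

interpretation ac: vector_space ac_scale
  by unfold_locales (simp_all add: ac_scale_def plus_fun_def algebra_simps fun_eq_iff)

lemma shear_add: "functional f \<Longrightarrow> shear f e (v + w) = shear f e v + shear f e w"
  and shear_ac_scale: "functional g \<Longrightarrow> shear g d (ac_scale c v') = ac_scale c (shear g d v')"
  by (simp_all add: shear_def functional_add functional_scale ac_scale_def fun_eq_iff algebra_simps)

section \<open>Edges of the diagram of a commutative Hecke algebra\<close>

locale commutative_hecke =
  fixes S :: "'s set" and m :: "'s \<Rightarrow> 's \<Rightarrow> enat" and q :: "'s \<Rightarrow> 'f::field"
  assumes finite_S: "finite S"
    and m_commute: "\<And>u w. u \<in> S \<Longrightarrow> w \<in> S \<Longrightarrow> u \<noteq> w \<Longrightarrow> m u w = m w u"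
    and m_ge_2: "\<And>u w. u \<in> S \<Longrightarrow> w \<in> S \<Longrightarrow> u \<noteq> w \<Longrightarrow> 2 \<le> m u w"
    and collapse_free: "collapse_free S m q"
    and commutative: "cring (hecke_algebra S m q)"
begin

text \<open>Collapse-freeness enters here: restricted to nonzero parameters it gives the equality
  that odd braid relations between shears require.\<close>

lemma exists_ac_burau_matrix: "\<exists>a. burau_matrix {u \<in> S. q u \<noteq> 0} m (\<lambda>u. to_ac (q u)) a"
proof (rule exists_burau_matrix)
  fix u w k
  assume "u \<in> {u \<in> S. q u \<noteq> 0}" "w \<in> {u \<in> S. q u \<noteq> 0}" "u \<noteq> w" "m u w = enat k" "odd k"
  moreover from this have "q u = q w \<or> q u = 0 \<or> q w = 0"
    using collapse_free unfolding collapse_free_def by blast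
  ultimately show "to_ac (q u) = to_ac (q w)" by auto
next
  show "finite {u \<in> S. q u \<noteq> 0}" using finite_S by simp
  show "m u w = m w u" if "u \<in> {u \<in> S. q u \<noteq> 0}" "w \<in> {u \<in> S. q u \<noteq> 0}" "u \<noteq> w" for u w
    using m_commute[of u w] that by simp
qed

lemma m_nat_ge_2: "u \<in> S \<Longrightarrow> w \<in> S \<Longrightarrow> u \<noteq> w \<Longrightarrow> m u w = enat k \<Longrightarrow> 2 \<le> k"
  using m_ge_2[of u w] by (simp add: numeral_eq_enat)

lemma edge_some_parameter_zero:
  assumes s: "s \<in> S" "q s \<noteq> 0" and t: "t \<in> S" "q t \<noteq> 0" and st: "s \<noteq> t" "3 \<le> m s t"
  shows False
proof -
  let ?U = "{u \<in> S. q u \<noteq> 0}"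
  obtain a where a: "burau_matrix ?U m (\<lambda>u. to_ac (q u)) a"
    using exists_ac_burau_matrix by blast
  define T where "T u = (if u \<in> ?U then burau a (\<lambda>_. 1) S u else (\<lambda>_ _. 0))" for u
  have T0: "T u (\<lambda>_. 0) = (\<lambda>_. 0)" for u
    by (simp add: T_def shear_def burau_functional_def)
  interpret hecke_module ac_scale T S m q
  proof unfold_locales
    fix u v assume u: "u \<in> S"
    show "T u (T u v) = T u v - ac_scale (q u) (T u v) + ac_scale (q u) v"
    proof (cases "u \<in> ?U")
      case True
      then show ?thesis
        using shear_quadratic[OF functional_burau, of a "\<lambda>_. 1" S u "unit_vector (Some u)" "to_ac (q u)" v] a u finite_S
        by (simp add: T_def burau_matrix_def ac_scale_def fun_eq_iff)
    qed (use u in \<open>auto simp: T_def ac_scale_def fun_eq_iff\<close>)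
  next
    fix u w k and v :: "'s option \<Rightarrow> 'f alg_closure"
    assume u: "u \<in> S" "w \<in> S" "u \<noteq> w" "m u w = enat k"
    note k = m_nat_ge_2[OF u]
    consider "u \<in> ?U" "w \<in> ?U" | "u \<notin> ?U" | "w \<notin> ?U" by blast
    then show "foldr T (alternating u w k) v = foldr T (alternating w u k) v"
    proof cases
      case 1
      with a u k show ?thesis
        by (intro burau_braid[OF a finite_S, where b = "\<lambda>_. 1"] m_commute) (auto simp: T_def)
    next
      case 2
      then have "T u = (\<lambda>_ _. 0)" unfolding T_def by presburger
      then show ?thesis using alternating_absorb[OF k, of T w u v] T0 by simp
    next
      case 3
      then have "T w = (\<lambda>_ _. 0)" unfolding T_def by presburger
      then show ?thesis using alternating_absorb[OF k, of T u w v] T0 by simp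
    qed
  next
    fix u c v and w :: "'s option \<Rightarrow> 'f alg_closure"
    show "T u (v + w) = T u v + T u w"
      by (cases "u \<in> ?U") (simp add: T_def shear_add functional_burau, auto simp add: T_def)
    show "T u (ac_scale c v) = ac_scale c (T u v)"
      by (cases "u \<in> ?U") (simp add: T_def shear_ac_scale functional_burau, auto simp add: T_def ac_scale_def)
  qed
  have f: "burau_functional a (\<lambda>_. 1) S u (shear (burau_functional a (\<lambda>_. 1) S w) (unit_vector (Some w)) (unit_vector None)) = 1 - a u w"
    if "w \<in> S" for u w
  proof -
    have "burau_functional a (\<lambda>_. 1) S u (\<lambda>x. unit_vector None x - 1 * unit_vector (Some w) x) = 1 - 1 * a u w"
      using functional_burau[of a "\<lambda>_. 1" S u, unfolded functional_def, rule_format, of "unit_vector None" 1 "unit_vector (Some w)"]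
        finite_S that by simp
    then show ?thesis by (simp add: shear_def)
  qed
  \<comment> \<open>Both functionals are 1 at \<open>None\<close>, so the coefficient of
    \<open>e_s\<close> is \<open>a s t - 1\<close> on the left and -1 on the right, and
    symmetrically for \<open>e_t\<close>. Commuting would make both entries vanish.\<close>
  have "T s (T t (unit_vector None)) = T t (T s (unit_vector None))"
    using commutative s t by (intro commutative_imp_commuting)
  from fun_cong[OF this, of "Some s"] fun_cong[OF this, of "Some t"] have "a s t = 0" "a t s = 0"
    using s t st f[OF s(1), of t] f[OF t(1), of s] by (simp_all add: T_def shear_def unit_vector_def)
  moreover have "a s t \<noteq> 0 \<or> a t s \<noteq> 0"
    using a s t st by (simp add: burau_matrix_def)
  ultimately show False by simp
qed

text \<open>
  The generator \<open>t\<close> acts as a projection of rank one; its image and its kernel are chosen so that \<open>s\<close> is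
  the only generator with nonzero parameter that does not fix both.
\<close>

lemma edge_zero_parameter:
  assumes s: "s \<in> S" and t: "t \<in> S" "q t = 0" and st: "s \<noteq> t" "3 \<le> m s t"
  shows "q s \<noteq> 0 \<and> (\<exists>k. m s t = enat k \<and> odd k)"
proof (rule ccontr)
  assume neg: "\<not> ?thesis"
  \<comment> \<open>If \<open>q s = 0\<close>, only \<open>s\<close> acts by a shear, and the other
    letters of nonzero parameter act by the identity: they may meet the idempotent \<open>s\<close>
    in an odd braid relation with unequal parameters. Otherwise all letters of nonzero parameter act
    by shears.\<close>
  define U where "U = (if q s = 0 then {s} else {u \<in> S. q u \<noteq> 0})"
  have "\<exists>a. burau_matrix U m (\<lambda>u. to_ac (q u)) a \<and> (q s = 0 \<longrightarrow> (\<forall>w. w \<noteq> s \<longrightarrow> a s w = 0))"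
  proof (cases "q s = 0")
    case True
    show ?thesis
      by (rule exI[of _ "\<lambda>u w. if u = w then 1 + to_ac (q u) else 0"]) (simp add: burau_matrix_def U_def True)
  qed (use exists_ac_burau_matrix in \<open>simp add: U_def\<close>)
  then obtain a where a: "burau_matrix U m (\<lambda>u. to_ac (q u)) a"
    and a0: "\<And>w. q s = 0 \<Longrightarrow> w \<noteq> s \<Longrightarrow> a s w = 0" by blast
  have U: "s \<in> U" "t \<notin> U" "U \<subseteq> S" using s t st by (auto simp: U_def)
  let ?b = "\<lambda>u. if u = s then 1 else 0 :: 'f alg_closure"
  \<comment> \<open>\<open>T t\<close> will project onto the line of \<open>unit_vector None\<close>
    along the kernel of \<open>h\<close>. Since \<open>b\<close> is 1 at \<open>s\<close>,
    \<open>T s\<close> sends \<open>e_None\<close> to \<open>e_None - e_s\<close>, which lies in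
    that kernel; this gives \<open>tst\<close>.\<close>
  define h where "h v = v (Some s) + v None" for v :: "'s option \<Rightarrow> 'f alg_closure"
  define T where "T u = (if u = t then (\<lambda>v x. h v * unit_vector None x)
    else if u \<in> U then burau a ?b S u
    else if u \<in> S \<and> q u \<noteq> 0 then (\<lambda>v. v) else (\<lambda>_ _. 0))" for u
  have Tt: "T t v = (\<lambda>x. h v * unit_vector None x)" for v by (simp add: T_def)
  have TU: "T u = burau a ?b S u" if "u \<in> U" for u using that U by (auto simp: T_def)
  have T_zero: "T u = (\<lambda>_ _. 0)" if "u \<noteq> t" "u \<notin> U" "q u = 0" for u
    using that by (simp add: T_def)
  have T_id: "T u = (\<lambda>v. v)" if "u \<noteq> t" "u \<notin> U" "u \<in> S" "q u \<noteq> 0" for u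
    using that by (simp add: T_def)
  have T0: "T u (\<lambda>_. 0) = (\<lambda>_. 0)" for u
    by (simp add: T_def shear_def burau_functional_def h_def)
  have auu: "a u u = 1 + to_ac (q u)" for u using a by (simp add: burau_matrix_def)
  have h_unit: "h (\<lambda>x. c * unit_vector None x) = c" for c by (simp add: h_def unit_vector_def)
  have bf_unit: "burau_functional a ?b S u (\<lambda>x. c * unit_vector None x) = c * ?b u" for u c
    using functional_scale[OF functional_burau[of a ?b S u], of c "unit_vector None"]
    unfolding burau_functional_None .
  have tst: "T t (T s (T t v)) = (\<lambda>_. 0)" for v
    by (simp add: Tt TU[OF U(1)] shear_def bf_unit) (simp add: h_def unit_vector_def)
  \<comment> \<open>With \<open>q s = 0\<close> the functional of \<open>s\<close> is
    \<open>h\<close> itself, so \<open>T s\<close> projects onto the kernel of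
    \<open>h\<close>.\<close>
  have ts: "T t (T s v) = (\<lambda>_. 0)" if "q s = 0" for v
  proof -
    have "(\<Sum>w\<in>S. a s w * v (Some w)) = (\<Sum>w\<in>S. if w = s then v (Some s) else 0)"
      using that by (intro sum.cong) (auto simp: a0 auu)
    then have "burau_functional a ?b S s v = h v"
      using s finite_S by (simp add: burau_functional_def h_def)
    then show ?thesis
      by (simp add: Tt TU[OF U(1)] shear_def) (simp add: h_def unit_vector_def)
  qed
  have tu: "T u (T t v) = T t v" "T t (T u v) = T t v" "T t (T t v) = T t v" if "u \<in> S" "q u \<noteq> 0" "u \<noteq> s" for u v
    using that t by (auto simp: T_def shear_def bf_unit h_unit) (auto simp: h_def unit_vector_def)
  \<comment> \<open>From length four on both alternating words contain \<open>t s t\<close>, whereas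
    \<open>s t s\<close> does not. Length three arises only if \<open>q s = 0\<close>, where
    \<open>t s\<close> already acts by 0.\<close>
  have zero: "foldr T (alternating s t k) v = (\<lambda>_. 0) \<and> foldr T (alternating t s k) v = (\<lambda>_. 0)"
    if k: "m s t = enat k" for k v
  proof -
    have 4: "foldr T (alternating s t (n + 4)) v = (\<lambda>_. 0) \<and> foldr T (alternating t s (n + 4)) v = (\<lambda>_. 0)" for n
      by (induction n) (simp_all add: eval_nat_numeral tst T0)
    have "3 \<le> k" using st(2) k by (simp add: numeral_eq_enat)
    show ?thesis
    proof (cases "q s = 0")
      case True
      then have "foldr T (alternating s t (n + 3)) v = (\<lambda>_. 0) \<and> foldr T (alternating t s (n + 3)) v = (\<lambda>_. 0)" for n
        by (induction n) (simp_all add: eval_nat_numeral ts T0)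
      from this[of "k - 3"] \<open>3 \<le> k\<close> show ?thesis by simp
    next
      case False
      with neg k have "even k" by auto
      with \<open>3 \<le> k\<close> have "4 \<le> k" by presburger
      with 4[of "k - 4"] show ?thesis by simp
    qed
  qed
  interpret hecke_module ac_scale T S m q
  proof unfold_locales
    fix u v assume u: "u \<in> S"
    consider "u = t" | "u \<noteq> t" "u \<in> U" | "u \<noteq> t" "u \<notin> U" by blast
    then show "T u (T u v) = T u v - ac_scale (q u) (T u v) + ac_scale (q u) v"
    proof cases
      case 1
      then show ?thesis by (simp add: Tt t h_unit ac_scale_def fun_eq_iff)
    next
      case 2
      then show ?thesis
        using shear_quadratic[OF functional_burau, of a ?b S u "unit_vector (Some u)" "to_ac (q u)" v] auu u finite_S
        by (simp add: T_def ac_scale_def fun_eq_iff)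
    next
      case 3
      then show ?thesis using u by (auto simp: T_def ac_scale_def fun_eq_iff)
    qed
  next
    fix u w k and v :: "'s option \<Rightarrow> 'f alg_closure"
    let ?P = "\<lambda>u w. foldr T (alternating u w k) v = foldr T (alternating w u k) v"
    let ?Z = "\<lambda>u. T u = (\<lambda>_ _. 0)"
    have Z: "?P u w" if "2 \<le> k" "?Z u" for u w
      using alternating_absorb[of k T w u v] that T0 by simp
    have I: "?P u w" if "2 \<le> k" "T u = (\<lambda>v. v)" "\<And>v. T w (T w v) = T w v" for u w
      using alternating_absorb[of k T u w v] that by simp
    have t': "?P u t" if u: "u \<in> S" "u \<noteq> t" "m u t = enat k" for u
    proof -
      note k = m_nat_ge_2[OF u(1) t(1) u(2,3)]
      consider "u = s" | "q u \<noteq> 0" "u \<noteq> s" | "?Z u" using T_zero[of u] u by (cases "u = s"; cases "q u = 0") (simp_all add: U_def)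
      then show ?thesis
      proof cases
        case 1
        then show ?thesis using zero[of k v] u by simp
      next
        case 2
        then show ?thesis using alternating_absorb[OF k, of T u t v] tu[OF u(1)] by simp
      qed (use Z k in blast)
    qed
    assume u: "u \<in> S" "w \<in> S" "u \<noteq> w" "m u w = enat k"
    then have u': "m w u = enat k" using m_commute by simp
    note k = m_nat_ge_2[OF u]
    have cases: "x \<in> U \<or> ?Z x \<or> T x = (\<lambda>v. v) \<and> q s = 0" if "x \<in> S" "x \<noteq> t" for x
      using that T_zero[of x] T_id[of x] by (cases "q x = 0"; cases "q s = 0"; cases "x \<in> U") (simp_all add: U_def)
    have idem: "T x (T x v) = T x v" if "x \<in> S" "x \<noteq> t" "q s = 0" for x v
    proof (cases "x = s")
      case True
      then show ?thesis
        using shear_quadratic[OF functional_burau, of a ?b S s "unit_vector (Some s)" 0 v] auu[of s] s finite_S that(3)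
        by (simp add: TU[OF U(1)] fun_eq_iff)
    next
      case False
      then have "x \<notin> U" using that by (simp add: U_def)
      then show ?thesis using that T_zero[of x] T_id[of x] by (cases "q x = 0") simp_all
    qed
    show "?P u w"
    proof (cases "u = t \<or> w = t")
      case True
      then show ?thesis using t'[of u] t'[of w] u u' by metis
    next
      case False
      with cases[of u] cases[of w] u consider "u \<in> U" "w \<in> U" | "?Z u" | "?Z w"
        | "T u = (\<lambda>v. v)" "q s = 0" | "T w = (\<lambda>v. v)" "q s = 0" by blast
      then show ?thesis
      proof cases
        case 1
        with u k show ?thesis
          by (intro burau_braid[OF a finite_S U(3), where b = ?b] m_commute TU) auto
      next
        case 2
        then show ?thesis using Z k by blast
      next
        case 3
        then show ?thesis using Z[of w u] k by simp
      next
        case 4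
        then show ?thesis using I[OF k, of u w] idem[of w] False u by blast
      next
        case 5
        then show ?thesis using I[OF k, of w u] idem[of u] False u by metis
      qed
    qed
  next
    fix u c v and w :: "'s option \<Rightarrow> 'f alg_closure"
    consider "u = t" | "u \<noteq> t" "u \<in> U" | "u \<noteq> t" "u \<notin> U" by blast
    then show "T u (v + w) = T u v + T u w" "T u (ac_scale c v) = ac_scale c (T u v)"
      by (cases; simp add: T_def shear_add shear_ac_scale functional_burau;
          auto simp: h_def fun_eq_iff ac_scale_def algebra_simps)+
  qed
  \<comment> \<open>\<open>T t\<close> fixes \<open>unit_vector None\<close>, so the right side is
    an instance of \<open>tst\<close> and vanishes, while the left side keeps the value 1 at
    \<open>None\<close>.\<close>
  have "T s (T t (unit_vector None)) = T t (T s (unit_vector None))"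
    using commutative s t by (intro commutative_imp_commuting)
  moreover have "unit_vector None = T t (unit_vector None)"
    by (simp add: Tt h_def unit_vector_def fun_eq_iff)
  ultimately have "T s (T t (unit_vector None)) = (\<lambda>_. 0)"
    using tst by metis
  from fun_cong[OF this, of None] show False
    by (simp add: TU[OF U(1)] Tt h_unit shear_def h_def unit_vector_def)
qed

end

section \<open>Linear independence of the independent sets\<close>

lemma alternating_commute:
  assumes "even k" and "\<And>v. T s (T t v) = T t (T s v)"
  shows "foldr T (alternating s t k) v = foldr T (alternating t s k) v"
proof -
  have "foldr T (alternating s t (2 * n)) v = foldr T (alternating t s (2 * n)) v" for n
    by (induction n) (simp_all add: assms(2))
  with \<open>even k\<close> show ?thesis by (auto elim: evenE)
qed

lemma mset_alternating: "mset (alternating s t (2 * n + 1)) = mset (replicate (Suc n) s @ replicate n t)"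
  by (induction n) simp_all

definition enumeration :: "'s set \<Rightarrow> 's list" where
  "enumeration J = (SOME w. set w = J \<and> distinct w)"

lemma enumeration:
  assumes "finite J"
  shows "set (enumeration J) = J" "distinct (enumeration J)"
  using someI_ex[OF finite_distinct_list[OF assms]] unfolding enumeration_def by blast+

lemma mset_enumeration: "finite J \<Longrightarrow> mset (enumeration J) = mset_set J"
  using enumeration[of J] mset_set_set by metis

definition fun_scale :: "'f::field \<Rightarrow> ('x \<Rightarrow> 'f) \<Rightarrow> 'x \<Rightarrow> 'f" where
  "fun_scale c v = (\<lambda>x. c * v x)"

interpretation fun_space: vector_space fun_scale
  by unfold_locales (simp_all add: fun_scale_def plus_fun_def algebra_simps fun_eq_iff)

lemma sum_fun_apply: "(\<Sum>x\<in>A. f x) y = (\<Sum>x\<in>A. f x y)"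
  by (induction A rule: infinite_finite_induct) simp_all

section \<open>The bipartite diagram and the action on functions of subsets\<close>

context commutative_hecke
begin

definition adj :: "'s \<Rightarrow> 's \<Rightarrow> bool" where
  "adj s t \<longleftrightarrow> {s, t} \<in> diagram_edges S m"

lemma adj_iff: "adj s t \<longleftrightarrow> s \<in> S \<and> t \<in> S \<and> s \<noteq> t \<and> 3 \<le> m s t"
proof
  assume "adj s t"
  then obtain x y where xy: "{s, t} = {x, y}" "x \<in> S" "y \<in> S" "x \<noteq> y" "3 \<le> m x y"
    by (auto simp: adj_def diagram_edges_def)
  then consider "s = x" "t = y" | "s = y" "t = x" by (auto simp: doubleton_eq_iff)
  then show "s \<in> S \<and> t \<in> S \<and> s \<noteq> t \<and> 3 \<le> m s t"
    using xy m_commute[of x y] by cases auto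
qed (auto simp: adj_def diagram_edges_def)

lemma adj_commute: "adj s t \<longleftrightarrow> adj t s"
  by (simp add: adj_def insert_commute)

text \<open>The diagram is thus bipartite, with idempotent letters on one side and invertible ones
  on the other.\<close>

lemma adj_parameters: "adj s t \<Longrightarrow> q s = 0 \<longleftrightarrow> q t \<noteq> 0"
  using edge_some_parameter_zero[of s t] edge_zero_parameter[of s t] by (auto simp: adj_iff)

lemma adj_odd: "adj s t \<Longrightarrow> \<exists>k. m s t = enat k \<and> odd k"
  using edge_zero_parameter[of s t] edge_zero_parameter[of t s] edge_some_parameter_zero[of s t] m_commute[of s t]
    adj_iff[of s t] by metis

definition absorbed :: "'s \<Rightarrow> 's set \<Rightarrow> bool" where
  "absorbed u I \<longleftrightarrow> (\<exists>z\<in>I. q z = 0 \<and> adj u z)"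

text \<open>
  A set \<open>J\<close> of letters with zero parameter selects a character of the subalgebra these idempotents
  generate.  Over it, the letters adjacent to \<open>J\<close> become \<open>1\<close>, and the remaining ones generate a tensor
  product of quadratic algebras, with basis indexed by sets \<open>K\<close>.  Below, \<open>I\<close> is \<open>J \<union> K\<close>.
\<close>

definition set_action :: "'s \<Rightarrow> ('s set \<Rightarrow> 'f) \<Rightarrow> 's set \<Rightarrow> 'f" where
  "set_action u v I =
    (if q u = 0 then (if u \<in> I then v I else 0)
     else if absorbed u I then v I
     else if u \<in> I then v (I - {u}) + (1 - q u) * v I
     else q u * v (insert u I))"

lemma absorbed_insert: "q w \<noteq> 0 \<Longrightarrow> absorbed u (insert w I) = absorbed u I"
  and absorbed_remove: "q w \<noteq> 0 \<Longrightarrow> absorbed u (I - {w}) = absorbed u I"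
  by (auto simp: absorbed_def)

text \<open>Letters of parameter 0 only restrict a function to sets containing them. The others move
  one element of \<open>I\<close>, which affects neither absorption nor the letters of parameter 0
  in \<open>I\<close>, so distinct letters work in separate coordinates.\<close>

lemma set_action_commute: "set_action u (set_action w v) = set_action w (set_action u v)"
proof (cases "u = w")
  case False
  then have "I - {u} - {w} = I - {w} - {u}" "insert u I - {w} = insert u (I - {w})"
    "insert w I - {u} = insert w (I - {u})" "insert u (insert w I) = insert w (insert u I)" for I
    by auto
  with False show ?thesis
    by (simp add: set_action_def fun_eq_iff absorbed_insert absorbed_remove algebra_simps)
qed simp

lemma set_action_absorb: "adj u z \<Longrightarrow> q z = 0 \<Longrightarrow> set_action z (set_action u v) = set_action z v"
  using adj_parameters[of u z] by (auto simp: set_action_def fun_eq_iff absorbed_def)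

text \<open>A letter of nonzero parameter that is not absorbed acts as multiplication by
  \<open>T_u\<close> on the coefficients of 1 and \<open>T_u\<close>, whence the quadratic relation.
  Even braid relations follow from commutation; odd ones occur only on edges, where the idempotent
  absorbs its neighbour.\<close>

lemma hecke_module_sets: "hecke_module fun_scale set_action S m q"
proof unfold_locales
  fix s :: 's and v :: "'s set \<Rightarrow> 'f"
  have "insert s (I - {s}) = I" if "s \<in> I" for I using that by auto
  moreover have "insert s I - {s} = I" if "s \<notin> I" for I using that by auto
  ultimately show "set_action s (set_action s v) = set_action s v - fun_scale (q s) (set_action s v) + fun_scale (q s) v"
    by (simp add: set_action_def fun_eq_iff absorbed_insert absorbed_remove fun_scale_def algebra_simps)
next
  fix s t k and v :: "'s set \<Rightarrow> 'f"
  assume st: "s \<in> S" "t \<in> S" "s \<noteq> t" "m s t = enat k"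
  show "foldr set_action (alternating s t k) v = foldr set_action (alternating t s k) v"
  proof (cases "even k")
    case True
    then show ?thesis by (rule alternating_commute) (rule set_action_commute)
  next
    case False
    have k: "2 \<le> k" using m_nat_ge_2 st by blast
    with False have "3 \<le> k" by presburger
    then have adj: "adj s t" using st by (simp add: adj_iff numeral_eq_enat)
    have *: "foldr set_action (alternating u z k) v = set_action z v"
      "foldr set_action (alternating z u k) v = set_action z v" if "adj u z" "q z = 0" for u z
    proof -
      have "set_action z (set_action z v) = set_action z v" for v
        using that by (simp add: set_action_def fun_eq_iff)
      moreover have "set_action z (set_action u v) = set_action z v" for v
        by (rule set_action_absorb[OF that])
      ultimately show "foldr set_action (alternating u z k) v = set_action z v"
        "foldr set_action (alternating z u k) v = set_action z v"
        by (intro alternating_absorb[OF k]; simp add: set_action_commute[of u z])+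
    qed
    from adj adj_parameters[OF adj] consider "adj s t" "q t = 0" | "adj t s" "q s = 0"
      using adj_commute by blast
    then show ?thesis by cases (simp_all only: *)
  qed
qed (simp_all add: set_action_def fun_eq_iff fun_scale_def algebra_simps)

sublocale sets: hecke_module fun_scale set_action S m q
  by (rule hecke_module_sets)

text \<open>The identity element of the tensor product for every \<open>J\<close>: coefficient 1 at
  empty \<open>K\<close>.\<close>

definition vacuum :: "'s set \<Rightarrow> 'f" where
  "vacuum I = (if \<forall>u\<in>I. q u = 0 then 1 else 0)"

text \<open>Without repeated letters the quadratic relation never intervenes: a new letter of
  nonzero parameter is either absorbed or inserted, and the terms with \<open>1 - q u\<close> and
  \<open>q u\<close> vanish because \<open>u\<close> does not occur in \<open>w\<close>.\<close>

lemma foldr_set_action_vacuum: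
  assumes "distinct w"
  shows "foldr set_action w vacuum I =
    (if (\<forall>z\<in>set w. q z = 0 \<longrightarrow> z \<in> I) \<and> (\<forall>u. u \<in> I \<and> q u \<noteq> 0 \<longleftrightarrow> u \<in> set w \<and> q u \<noteq> 0 \<and> \<not> absorbed u I) then 1 else 0)"
  using assms
proof (induction w arbitrary: I)
  case Nil
  show ?case by (auto simp: vacuum_def)
next
  case (Cons u w)
  have IH: "foldr set_action w vacuum I =
    (if (\<forall>z\<in>set w. q z = 0 \<longrightarrow> z \<in> I) \<and> (\<forall>u. u \<in> I \<and> q u \<noteq> 0 \<longleftrightarrow> u \<in> set w \<and> q u \<noteq> 0 \<and> \<not> absorbed u I) then 1 else 0)" for I
    using Cons by simp
  have u: "u \<notin> set w" using Cons.prems by simp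
  consider "q u = 0" | "q u \<noteq> 0" "absorbed u I" | "q u \<noteq> 0" "\<not> absorbed u I" "u \<in> I"
    | "q u \<noteq> 0" "\<not> absorbed u I" "u \<notin> I" by blast
  then show ?case
  proof cases
    case 1
    then have N: "(u' \<in> set (u # w) \<and> q u' \<noteq> 0 \<and> \<not> absorbed u' I) = (u' \<in> set w \<and> q u' \<noteq> 0 \<and> \<not> absorbed u' I)" for u'
      by auto
    have Z: "(\<forall>z\<in>set (u # w). q z = 0 \<longrightarrow> z \<in> I) = (u \<in> I \<and> (\<forall>z\<in>set w. q z = 0 \<longrightarrow> z \<in> I))"
      using 1 by auto
    have "foldr set_action (u # w) vacuum I = (if u \<in> I then foldr set_action w vacuum I else 0)"
      using 1 by (simp add: set_action_def)
    then show ?thesis unfolding N Z IH by (cases "u \<in> I") simp_all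
  next
    case 2
    then have N: "(u' \<in> set (u # w) \<and> q u' \<noteq> 0 \<and> \<not> absorbed u' I) = (u' \<in> set w \<and> q u' \<noteq> 0 \<and> \<not> absorbed u' I)" for u'
      by auto
    have Z: "(\<forall>z\<in>set (u # w). q z = 0 \<longrightarrow> z \<in> I) = (\<forall>z\<in>set w. q z = 0 \<longrightarrow> z \<in> I)"
      using 2 by auto
    have "foldr set_action (u # w) vacuum I = foldr set_action w vacuum I"
      using 2 by (simp add: set_action_def)
    then show ?thesis unfolding N Z IH .
  next
    case 3
    have "foldr set_action w vacuum I = 0" using 3 u unfolding IH by auto
    moreover have "foldr set_action w vacuum (I - {u}) =
      (if (\<forall>z\<in>set (u # w). q z = 0 \<longrightarrow> z \<in> I) \<and> (\<forall>u'. u' \<in> I \<and> q u' \<noteq> 0 \<longleftrightarrow> u' \<in> set (u # w) \<and> q u' \<noteq> 0 \<and> \<not> absorbed u' I) then 1 else 0)"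
      unfolding IH absorbed_remove[OF 3(1)]
    proof (intro if_cong refl arg_cong2[of _ _ _ _ "(\<and>)"] iff_allI)
      show "(\<forall>z\<in>set w. q z = 0 \<longrightarrow> z \<in> I - {u}) = (\<forall>z\<in>set (u # w). q z = 0 \<longrightarrow> z \<in> I)"
        using 3(1) by auto
      show "(u' \<in> I - {u} \<and> q u' \<noteq> 0 \<longleftrightarrow> u' \<in> set w \<and> q u' \<noteq> 0 \<and> \<not> absorbed u' I)
        = (u' \<in> I \<and> q u' \<noteq> 0 \<longleftrightarrow> u' \<in> set (u # w) \<and> q u' \<noteq> 0 \<and> \<not> absorbed u' I)" for u'
        using 3 u by (cases "u' = u") simp_all
    qed
    moreover have "foldr set_action (u # w) vacuum I
      = foldr set_action w vacuum (I - {u}) + (1 - q u) * foldr set_action w vacuum I"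
      using 3 by (simp add: set_action_def[of u])
    ultimately show ?thesis by (simp only: mult_zero_right add_0_right)
  next
    case 4
    have "foldr set_action w vacuum (insert u I) = 0" using 4 u unfolding IH by auto
    moreover have "foldr set_action (u # w) vacuum I = q u * foldr set_action w vacuum (insert u I)"
      using 4 by (simp add: set_action_def[of u])
    moreover have "\<not> (\<forall>u'. u' \<in> I \<and> q u' \<noteq> 0 \<longleftrightarrow> u' \<in> set (u # w) \<and> q u' \<noteq> 0 \<and> \<not> absorbed u' I)"
      using 4 by auto
    ultimately show ?thesis by (simp only: mult_zero_right simp_thms if_False)
  qed
qed

abbreviation indep :: "'s set set" where
  "indep \<equiv> independent_sets S (diagram_edges S m)"

lemma indep_iff: "J \<in> indep \<longleftrightarrow> J \<subseteq> S \<and> (\<forall>s\<in>J. \<forall>t\<in>J. \<not> adj s t)"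
  by (auto simp: independent_sets_def pairwise_def adj_def[symmetric]) (auto simp: adj_iff)

lemma finite_indep: "finite indep"
  by (rule finite_subset[of _ "Pow S"]) (auto simp: independent_sets_def finite_S)

lemma finite_of_indep: "J \<in> indep \<Longrightarrow> finite J"
  by (auto simp: independent_sets_def intro: finite_subset[OF _ finite_S])

text \<open>Triangularity: evaluate at a set \<open>J\<close> with nonzero coefficient and fewest
  letters of parameter 0. If \<open>L\<close> also has nonzero coefficient and its word is nonzero
  at \<open>J\<close>, its letters of parameter 0 lie in \<open>J\<close>, so by minimality they are
  the same. Then absorption by \<open>J\<close> and \<open>L\<close> agrees, and an independent set
  absorbs none of its own letters, so \<open>L = J\<close>.\<close>

lemma indep_words_independent:
  assumes "(\<Sum>J\<in>indep. const (c J) * word (enumeration J)) \<in> hecke_ideal S m q" and "J \<in> indep"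
  shows "c J = 0"
proof (rule ccontr)
  assume "c J \<noteq> 0"
  define Z where "Z J = {z \<in> J. q z = 0}" for J
  define P where "P J \<longleftrightarrow> J \<in> indep \<and> c J \<noteq> 0" for J
  have "P J" using assms(2) \<open>c J \<noteq> 0\<close> by (simp add: P_def)
  then obtain J where J: "P J" and min: "\<And>L. P L \<Longrightarrow> card (Z J) \<le> card (Z L)"
    using ex_has_least_nat[of P J "\<lambda>J. card (Z J)"] by blast
  have fin: "finite J" using J finite_of_indep by (simp add: P_def)
  have val: "c L * foldr set_action (enumeration L) vacuum J = (if L = J then c J else 0)" if L: "L \<in> indep" for L
  proof (cases "c L = 0")
    case False
    have enum: "set (enumeration L) = L" "distinct (enumeration L)"
      using enumeration finite_of_indep L by blast+
    note val = foldr_set_action_vacuum[OF enum(2), of J, unfolded enum(1)]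
    have nabs: "\<not> absorbed u L" if "u \<in> L" for u using that L by (auto simp: indep_iff absorbed_def)
    show ?thesis
    proof (cases "L = J")
      case True
      with nabs show ?thesis unfolding val using L by auto
    next
      case neq: False
      have "\<not> ((\<forall>z\<in>L. q z = 0 \<longrightarrow> z \<in> J) \<and> (\<forall>u. u \<in> J \<and> q u \<noteq> 0 \<longleftrightarrow> u \<in> L \<and> q u \<noteq> 0 \<and> \<not> absorbed u J))"
      proof
        assume *: "(\<forall>z\<in>L. q z = 0 \<longrightarrow> z \<in> J) \<and> (\<forall>u. u \<in> J \<and> q u \<noteq> 0 \<longleftrightarrow> u \<in> L \<and> q u \<noteq> 0 \<and> \<not> absorbed u J)"
        then have "Z L \<subseteq> Z J" by (auto simp: Z_def)
        moreover have "card (Z J) \<le> card (Z L)" using min[of L] L False by (simp add: P_def)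
        ultimately have Z: "Z L = Z J" using fin by (intro card_seteq) (auto simp: Z_def)
        then have "absorbed u J = absorbed u L" for u by (auto simp: absorbed_def Z_def set_eq_iff)
        with * nabs have "u \<in> J \<and> q u \<noteq> 0 \<longleftrightarrow> u \<in> L \<and> q u \<noteq> 0" for u by metis
        with Z have "L = J" by (auto simp: Z_def set_eq_iff)
        with neq show False ..
      qed
      then have "foldr set_action (enumeration L) vacuum J = 0" unfolding val by (rule if_not_P)
      with neq show ?thesis by simp
    qed
  qed auto
  have "0 = sets.act (\<Sum>J\<in>indep. const (c J) * word (enumeration J)) vacuum J"
    using sets.act_hecke_ideal[OF assms(1)] by simp
  also have "\<dots> = (\<Sum>L\<in>indep. c L * foldr set_action (enumeration L) vacuum J)"
    by (simp add: sets.act_sum sets.act_mult fun_scale_def sum_fun_apply)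
  also have "\<dots> = (\<Sum>L\<in>indep. if L = J then c J else 0)"
    by (rule sum.cong) (simp_all add: val)
  also have "\<dots> = c J"
    using finite_indep J by (simp add: P_def)
  finally show False using J by (simp add: P_def)
qed

end

section \<open>Spanning by the independent sets\<close>

locale hecke_congruence =
  fixes S :: "'s set" and m :: "'s \<Rightarrow> 's \<Rightarrow> enat" and q :: "'s \<Rightarrow> 'f::field"
begin

definition eqv :: "('s list \<Rightarrow>\<^sub>0 'f) \<Rightarrow> ('s list \<Rightarrow>\<^sub>0 'f) \<Rightarrow> bool" (infix \<open>\<asymp>\<close> 50) where
  "p \<asymp> r \<longleftrightarrow> p - r \<in> hecke_ideal S m q"

abbreviation polys :: "('s list \<Rightarrow>\<^sub>0 'f) set" where
  "polys \<equiv> carrier (free_algebra S)"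

lemma
  shows ideal_0: "0 \<in> hecke_ideal S m q"
    and ideal_add: "x \<in> hecke_ideal S m q \<Longrightarrow> y \<in> hecke_ideal S m q \<Longrightarrow> x + y \<in> hecke_ideal S m q"
    and ideal_uminus: "x \<in> hecke_ideal S m q \<Longrightarrow> - x \<in> hecke_ideal S m q"
    and ideal_l: "x \<in> hecke_ideal S m q \<Longrightarrow> p \<in> polys \<Longrightarrow> p * x \<in> hecke_ideal S m q"
    and ideal_r: "x \<in> hecke_ideal S m q \<Longrightarrow> p \<in> polys \<Longrightarrow> x * p \<in> hecke_ideal S m q"
proof -
  let ?R = "free_algebra S :: ('s list \<Rightarrow>\<^sub>0 'f) ring"
  interpret ring ?R by (rule ring_free_algebra)
  interpret ideal "hecke_ideal S m q" ?R by (rule hecke_ideal_ideal)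
  show "0 \<in> hecke_ideal S m q" using zero_closed additive_subgroup.zero_closed[OF additive_subgroup_axioms] by simp
  show "x \<in> hecke_ideal S m q \<Longrightarrow> y \<in> hecke_ideal S m q \<Longrightarrow> x + y \<in> hecke_ideal S m q"
    using a_closed[of x y] by simp
  show "- x \<in> hecke_ideal S m q" if x: "x \<in> hecke_ideal S m q"
  proof -
    have "\<ominus>\<^bsub>?R\<^esub> x = - x"
      by (rule minus_equality) (use a_Hcarr[OF x] in simp_all)
    with a_inv_closed[OF x] show ?thesis by simp
  qed
  show "x \<in> hecke_ideal S m q \<Longrightarrow> p \<in> polys \<Longrightarrow> p * x \<in> hecke_ideal S m q"
    using I_l_closed[of x p] by simp
  show "x \<in> hecke_ideal S m q \<Longrightarrow> p \<in> polys \<Longrightarrow> x * p \<in> hecke_ideal S m q"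
    using I_r_closed[of x p] by simp
qed

lemma polys_mult: "p \<in> polys \<Longrightarrow> r \<in> polys \<Longrightarrow> p * r \<in> polys"
  and polys_add: "p \<in> polys \<Longrightarrow> r \<in> polys \<Longrightarrow> p + r \<in> polys"
  and polys_1: "1 \<in> polys" and polys_0: "0 \<in> polys"
  using ring.ring_simprules(1,2,5,6)[OF ring_free_algebra[where S = S and 'f = 'f]] by simp_all

lemma polys_word: "w \<in> lists S \<Longrightarrow> word w \<in> polys"
  and polys_gen: "s \<in> S \<Longrightarrow> gen s \<in> polys"
  and polys_const: "const c \<in> polys"
  by (auto simp: gen_def const_def)

lemma polys_power: "p \<in> polys \<Longrightarrow> p ^ n \<in> polys"
  by (induction n) (simp_all only: power.simps polys_1 polys_mult)

lemma polys_sum: "(\<And>x. x \<in> A \<Longrightarrow> p x \<in> polys) \<Longrightarrow> sum p A \<in> polys"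
  by (induction A rule: infinite_finite_induct) (simp_all only: sum.infinite sum.empty sum.insert polys_0 polys_add insert_iff simp_thms)

lemma eqv_refl [simp]: "p \<asymp> p"
  by (simp add: eqv_def ideal_0)

lemma eqv_sym: "p \<asymp> r \<Longrightarrow> r \<asymp> p"
  using ideal_uminus[of "p - r"] by (simp add: eqv_def)

lemma eqv_trans [trans]: "p \<asymp> r \<Longrightarrow> r \<asymp> x \<Longrightarrow> p \<asymp> x"
  using ideal_add[of "p - r" "r - x"] by (simp add: eqv_def)

lemma eqv_add: "p \<asymp> r \<Longrightarrow> p' \<asymp> r' \<Longrightarrow> p + p' \<asymp> r + r'"
  using ideal_add[of "p - r" "p' - r'"] by (simp add: eqv_def algebra_simps)

lemma eqv_mult_left: "x \<in> polys \<Longrightarrow> p \<asymp> r \<Longrightarrow> x * p \<asymp> x * r"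
  using ideal_l[of "p - r" x] by (simp add: eqv_def right_diff_distrib)

lemma eqv_mult_right: "x \<in> polys \<Longrightarrow> p \<asymp> r \<Longrightarrow> p * x \<asymp> r * x"
  using ideal_r[of "p - r" x] by (simp add: eqv_def left_diff_distrib)

lemma gen_square:
  assumes "s \<in> S"
  shows "gen s * gen s \<asymp> const (1 - q s) * gen s + const (q s)"
proof -
  have "(gen s - 1) * (gen s + const (q s)) \<in> hecke_ideal S m q"
    using hecke_relators_in_ideal[of S m q] assms by (auto simp: hecke_relators_def)
  moreover have "gen s * const (q s) = const (q s) * gen s"
    by (simp add: gen_def const_def mult_single plus_list_def)
  ultimately show ?thesis
    by (simp add: eqv_def algebra_simps const_diff const_1)
qed

end

sublocale commutative_hecke \<subseteq> hecke_congruence S m q .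

context commutative_hecke
begin

lemma eqv_commute: "p \<in> polys \<Longrightarrow> r \<in> polys \<Longrightarrow> p * r \<asymp> r * p"
  unfolding eqv_def by (rule hecke_commutator[OF commutative])

text \<open>Reduces every later rearrangement of letters to a computation with multisets.\<close>

lemma eqv_word_mset:
  assumes "u \<in> lists S" "mset u = mset w"
  shows "word u \<asymp> (word w :: 's list \<Rightarrow>\<^sub>0 'f)"
  using assms
proof (induction u arbitrary: w rule: list.induct)
  case (Cons a u)
  then have "a \<in> set w" by (metis list.set_intros(1) set_mset_mset)
  then obtain x y where w: "w = x @ a # y" by (meson split_list)
  have "set w = set (a # u)" using Cons.prems(2) by (metis set_mset_mset)
  then have S: "a \<in> S" "x \<in> lists S" "y \<in> lists S" using Cons.prems(1) w by auto
  have "word (a # u) = word [a] * word u" by (simp add: word_mult)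
  also have "\<dots> \<asymp> word [a] * word (x @ y)"
    using Cons w S by (intro eqv_mult_left Cons.IH polys_word) auto
  also have "\<dots> = (word [a] * word x) * word y" by (simp add: word_mult)
  also have "\<dots> \<asymp> (word x * word [a]) * word y"
    using S by (intro eqv_mult_right eqv_commute polys_word) auto
  also have "\<dots> = word w" by (simp add: word_mult w)
  finally show ?case .
qed simp

lemma gen_idempotent_power:
  assumes "s \<in> S" "q s = 0"
  shows "gen s ^ Suc n \<asymp> gen s"
proof (induction n)
  case (Suc n)
  have "gen s ^ Suc (Suc n) = gen s * gen s ^ Suc n" by simp
  also have "\<dots> \<asymp> gen s * gen s" by (intro eqv_mult_left polys_gen assms Suc)
  also have "\<dots> \<asymp> gen s" using gen_square[OF assms(1)] assms by (simp add: const_0 const_1)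
  finally show ?case .
qed simp

lemma gen_invertible:
  assumes "s \<in> S" "q s \<noteq> 0"
  obtains y where "y \<in> polys" "gen s * y \<asymp> 1"
proof
  \<comment> \<open>Solves \<open>T^2 = (1 - q) T + q\<close> for the inverse of
    \<open>T\<close>.\<close>
  let ?y = "const (inverse (q s)) * (gen s + const (q s - 1))"
  show "?y \<in> polys" by (intro polys_mult polys_add polys_const polys_gen assms)
  have c: "gen s * const c = const c * gen s" for c :: 'f
    by (simp add: gen_def const_def mult_single plus_list_def)
  have "gen s * ?y = const (inverse (q s)) * (gen s * gen s + const (q s - 1) * gen s)"
    by (simp add: c distrib_left flip: mult.assoc) (simp add: c mult.assoc)
  also have "\<dots> \<asymp> const (inverse (q s)) * ((const (1 - q s) * gen s + const (q s)) + const (q s - 1) * gen s)"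
    by (intro eqv_mult_left eqv_add polys_const gen_square assms eqv_refl)
  also have "\<dots> = 1"
    using assms by (simp add: const_diff const_1 algebra_simps flip: const_mult)
  finally show "gen s * ?y \<asymp> 1" .
qed

lemma word_replicate: "word (replicate n s) = (gen s ^ n :: 's list \<Rightarrow>\<^sub>0 'f)"
proof (induction n)
  case (Suc n)
  have "word (replicate (Suc n) s) = (gen s * word (replicate n s) :: 's list \<Rightarrow>\<^sub>0 'f)"
    by (simp add: gen_word word_mult)
  with Suc show ?case by simp
qed (simp add: zero_list_def flip: single_one)

text \<open>
  Commutativity turns the braid relation of length \<open>2j + 1\<close> into \<open>s\<^sup>j\<^sup>+\<^sup>1 t\<^sup>j = s\<^sup>j t\<^sup>j\<^sup>+\<^sup>1\<close>, where \<open>s\<close> is idempotent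
  and \<open>t\<close> is invertible.
\<close>

lemma adj_gen_mult:
  assumes "adj s t" "q s = 0"
  shows "gen s * gen t \<asymp> gen s"
proof -
  have st: "s \<in> S" "t \<in> S" "s \<noteq> t" "3 \<le> m s t" and qt: "q t \<noteq> 0"
    using assms adj_parameters[OF assms(1)] by (auto simp: adj_iff)
  obtain k where k: "m s t = enat k" "odd k" using adj_odd[OF assms(1)] by blast
  then obtain j where j: "k = 2 * j + 1" by (auto elim: oddE)
  \<comment> \<open>The power \<open>gen s ^ j\<close> must contain at least one factor before
    idempotence can reduce it to \<open>gen s\<close>.\<close>
  then have "j \<noteq> 0" using k st by (auto simp: numeral_eq_enat one_enat_def)
  then obtain i where i: "j = Suc i" by (cases j) auto
  have gens: "gen s \<in> polys" "gen t \<in> polys" using st polys_gen by blast+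
  note pw = polys_power[OF gens(1)] polys_power[OF gens(2)]
  have alt: "word (alternating a b k) \<asymp> gen a ^ Suc j * gen b ^ j" if "a \<in> S" "b \<in> S" for a b
  proof -
    have "set (alternating a b n) \<subseteq> {a, b}" for n
      by (induction n arbitrary: a b) (simp, fastforce)
    from this[of k] have "alternating a b k \<in> lists S"
      using that by (auto simp: in_lists_conv_set)
    then have "word (alternating a b k) \<asymp> word (replicate (Suc j) a @ replicate j b)"
      by (rule eqv_word_mset) (simp only: j mset_alternating)
    also have "\<dots> = gen a ^ Suc j * gen b ^ j"
      by (simp only: word_replicate flip: word_mult)
    finally show ?thesis .
  qed
  have "word (alternating s t k) \<asymp> word (alternating t s k)"
    unfolding eqv_def using hecke_relators_in_ideal[of S m q] st k
    unfolding hecke_relators_def prod_list_alternating by blast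
  then have "gen s ^ Suc j * gen t ^ j \<asymp> gen t ^ Suc j * gen s ^ j"
    using alt[of s t] alt[of t s] st eqv_sym eqv_trans by meson
  also have "\<dots> \<asymp> gen s ^ j * gen t ^ Suc j" by (intro eqv_commute pw)
  finally have braid: "gen s ^ Suc j * gen t ^ j \<asymp> gen s ^ j * gen t ^ Suc j" .
  have s: "gen s ^ Suc n * gen t ^ l \<asymp> gen s * gen t ^ l" for n l
    by (intro eqv_mult_right pw gen_idempotent_power st assms)
  have "gen s * gen t ^ j \<asymp> gen s * gen t ^ Suc j"
    using s[of j j] s[of i "Suc j"] braid i eqv_sym eqv_trans by meson
  moreover obtain y where y: "y \<in> polys" "gen t * y \<asymp> 1" using gen_invertible st qt by blast
  \<comment> \<open>Multiplication by \<open>y\<close> lowers both exponents of \<open>gen t\<close>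
    by one, down to exponents 0 and 1.\<close>
  have "gen s * gen t ^ n \<asymp> gen s * gen t ^ Suc n \<Longrightarrow> gen s \<asymp> gen s * gen t" for n
  proof (induction n)
    case (Suc n)
    have cancel: "gen s * gen t ^ Suc l * y \<asymp> gen s * gen t ^ l" for l
    proof -
      have "gen s * gen t ^ Suc l * y = (gen s * gen t ^ l) * (gen t * y)"
        by (simp only: power_Suc2 mult.assoc)
      also have "\<dots> \<asymp> (gen s * gen t ^ l) * 1"
        by (intro eqv_mult_left polys_mult gens pw y)
      finally show ?thesis by simp
    qed
    have "gen s * gen t ^ Suc n * y \<asymp> gen s * gen t ^ Suc (Suc n) * y"
      by (rule eqv_mult_right[OF y(1) Suc.prems])
    with cancel show ?case using Suc.IH eqv_sym eqv_trans by meson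
  qed simp
  ultimately show ?thesis using eqv_sym by blast
qed

section \<open>The span of the words of independent sets\<close>

definition spanned :: "('s list \<Rightarrow>\<^sub>0 'f) set" where
  "spanned = {p. \<exists>c. p \<asymp> (\<Sum>J\<in>indep. const (c J) * word (enumeration J))}"

lemma spanned_eqv: "p \<in> spanned \<Longrightarrow> r \<asymp> p \<Longrightarrow> r \<in> spanned"
  unfolding spanned_def using eqv_trans by blast

lemma spanned_add: "p \<in> spanned \<Longrightarrow> r \<in> spanned \<Longrightarrow> p + r \<in> spanned"
proof -
  assume "p \<in> spanned" "r \<in> spanned"
  then obtain c d where "p \<asymp> (\<Sum>J\<in>indep. const (c J) * word (enumeration J))"
    "r \<asymp> (\<Sum>J\<in>indep. const (d J) * word (enumeration J))"
    by (auto simp: spanned_def)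
  from eqv_add[OF this] have "p + r \<asymp> (\<Sum>J\<in>indep. const (c J + d J) * word (enumeration J))"
    by (simp add: const_add distrib_right sum.distrib)
  then show "p + r \<in> spanned" unfolding spanned_def by (intro CollectI exI)
qed

lemma spanned_const: "p \<in> spanned \<Longrightarrow> const a * p \<in> spanned"
proof -
  assume "p \<in> spanned"
  then obtain c where "p \<asymp> (\<Sum>J\<in>indep. const (c J) * word (enumeration J))"
    by (auto simp: spanned_def)
  from eqv_mult_left[OF polys_const this, of a]
  have "const a * p \<asymp> (\<Sum>J\<in>indep. const (a * c J) * word (enumeration J))"
    by (simp add: const_mult sum_distrib_left mult.assoc)
  then show "const a * p \<in> spanned" unfolding spanned_def by (intro CollectI exI)
qed

lemma spanned_0: "0 \<in> spanned"
  unfolding spanned_def by (intro CollectI exI[of _ "\<lambda>_. 0"]) (simp add: const_0)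

lemma spanned_sum: "(\<And>x. x \<in> A \<Longrightarrow> p x \<in> spanned) \<Longrightarrow> sum p A \<in> spanned"
  by (induction A rule: infinite_finite_induct) (simp_all add: spanned_0 spanned_add)

lemma spanned_basis: "J \<in> indep \<Longrightarrow> word (enumeration J) \<in> spanned"
proof -
  assume "J \<in> indep"
  then have "word (enumeration J) = (\<Sum>L\<in>indep. if L = J then word (enumeration J) else 0 :: 's list \<Rightarrow>\<^sub>0 'f)"
    using finite_indep by simp
  also have "\<dots> = (\<Sum>L\<in>indep. const (if L = J then 1 else 0) * word (enumeration L))"
    by (rule sum.cong) (auto simp: const_0 const_1)
  finally have "word (enumeration J) \<asymp> (\<Sum>L\<in>indep. const (if L = J then 1 else 0) * word (enumeration L))"
    by (simp only: eqv_refl)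
  then show "word (enumeration J) \<in> spanned" unfolding spanned_def by (intro CollectI exI)
qed

lemma enumeration_lists: "J \<in> indep \<Longrightarrow> enumeration J \<in> lists S"
  using enumeration(1)[of J] finite_of_indep by (auto simp: independent_sets_def)

lemma adj_word_absorb:
  assumes "q s = 0" "\<And>t. t \<in> set w \<Longrightarrow> adj s t" "u \<in> lists S" "s \<in> S"
  shows "word (s # w @ u) \<asymp> word (s # u)"
  using assms(2)
proof (induction w)
  case (Cons t w)
  then have t: "adj s t" "set w \<subseteq> S" by (auto simp: adj_iff)
  have "word (s # (t # w) @ u) = (gen s * gen t) * word (w @ u)"
    by (simp add: gen_word word_mult)
  also have "\<dots> \<asymp> gen s * word (w @ u)"
    using t assms by (intro eqv_mult_right polys_word adj_gen_mult) auto
  also have "\<dots> = word (s # w @ u)" by (simp add: gen_word word_mult)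
  also have "\<dots> \<asymp> word (s # u)" using Cons by simp
  finally show ?case .
qed simp

text \<open>If \<open>s \<in> J\<close>, the quadratic relation applies; a neighbour of parameter 0
  in \<open>J\<close> absorbs \<open>s\<close>. Otherwise all neighbours of \<open>s\<close> in
  \<open>J\<close> have nonzero parameter and \<open>s\<close> absorbs them, leaving
  \<open>s\<close> together with its non-neighbours, again an independent set.\<close>

lemma spanned_gen_basis:
  assumes s: "s \<in> S" and J: "J \<in> indep"
  shows "word (s # enumeration J) \<in> spanned"
proof -
  have fin: "finite J" and JS: "J \<subseteq> S" using J finite_of_indep by (auto simp: independent_sets_def)
  have sub: "L \<in> indep" if "L \<subseteq> J" for L using J that by (auto simp: indep_iff)
  consider "s \<in> J" | t where "s \<notin> J" "t \<in> J" "adj s t" "q t = 0"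
    | "s \<notin> J" "\<And>t. t \<in> J \<Longrightarrow> adj s t \<Longrightarrow> q t \<noteq> 0" by blast
  then show ?thesis
  proof cases
    case 1
    let ?w = "enumeration (J - {s})"
    have w: "?w \<in> lists S" "J - {s} \<in> indep" using sub[of "J - {s}"] enumeration_lists by blast+
    have "word (s # enumeration J) \<asymp> word (s # s # ?w)"
      using s 1 fin enumeration_lists[OF J] by (intro eqv_word_mset) (auto simp: mset_enumeration mset_set.remove)
    also have "\<dots> = (gen s * gen s) * word ?w" by (simp add: gen_word word_mult)
    also have "\<dots> \<asymp> (const (1 - q s) * gen s + const (q s)) * word ?w"
      by (intro eqv_mult_right gen_square polys_word s w)
    also have "\<dots> = const (1 - q s) * word (s # ?w) + const (q s) * word ?w"
      by (simp add: gen_word word_mult distrib_right mult.assoc)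
    finally have *: "word (s # enumeration J) \<asymp> const (1 - q s) * word (s # ?w) + const (q s) * word ?w" .
    have "word (s # ?w) \<asymp> word (enumeration J)"
      using s 1 fin w by (intro eqv_word_mset) (auto simp: mset_enumeration mset_set.remove)
    then have "word (s # ?w) \<in> spanned" using spanned_basis[OF J] spanned_eqv by blast
    then show ?thesis
      using * spanned_basis[OF w(2)] by (blast intro: spanned_eqv spanned_add spanned_const)
  next
    case 2
    let ?w = "enumeration (J - {t})"
    have w: "?w \<in> lists S" "t \<in> S" using sub[of "J - {t}"] enumeration_lists 2 JS by blast+
    have "word (s # enumeration J) \<asymp> word (t # [s] @ ?w)"
      using s 2 fin enumeration_lists[OF J] by (intro eqv_word_mset) (auto simp: mset_enumeration mset_set.remove)
    also have "\<dots> \<asymp> word (t # ?w)"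
      using 2 w adj_commute[of s t] by (intro adj_word_absorb) auto
    also have "\<dots> \<asymp> word (enumeration J)"
      using 2 fin w by (intro eqv_word_mset) (auto simp: mset_enumeration mset_set.remove)
    finally show ?thesis using spanned_basis[OF J] spanned_eqv by blast
  next
    case 3
    let ?A = "{t \<in> J. adj s t}" and ?B = "{t \<in> J. \<not> adj s t}"
    let ?w = "enumeration ?B"
    have w: "?w \<in> lists S" using sub[of ?B] enumeration_lists by blast
    have I: "insert s ?B \<in> indep"
      using J s adj_commute by (auto simp: indep_iff) (auto simp: adj_iff)
    have "mset_set J = mset_set ?A + mset_set ?B"
      using fin by (subst mset_set_Union[symmetric]) (auto intro: arg_cong[of _ _ mset_set])
    then have "word (s # enumeration J) \<asymp> word (s # enumeration ?A @ ?w)"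
      using s fin enumeration_lists[OF J] by (intro eqv_word_mset) (auto simp: mset_enumeration)
    also have "\<dots> \<asymp> word (s # ?w)"
    proof (cases "?A = {}")
      case True
      then have "enumeration ?A = []" using enumeration(1)[of ?A] unfolding True by simp
      then show ?thesis by simp
    next
      case False
      then have "q s = 0" using 3 adj_parameters by blast
      then show ?thesis using s w fin enumeration(1)[of ?A] by (intro adj_word_absorb) auto
    qed
    also have "\<dots> \<asymp> word (enumeration (insert s ?B))"
      using 3 s fin w by (intro eqv_word_mset) (auto simp: mset_enumeration)
    finally show ?thesis using spanned_basis[OF I] spanned_eqv by blast
  qed
qed

lemma spanned_gen:
  assumes s: "s \<in> S" and p: "p \<in> spanned"
  shows "gen s * p \<in> spanned"
proof -
  obtain c where "p \<asymp> (\<Sum>J\<in>indep. const (c J) * word (enumeration J))"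
    using p by (auto simp: spanned_def)
  from eqv_mult_left[OF polys_gen[OF s] this]
  have "gen s * p \<asymp> (\<Sum>J\<in>indep. const (c J) * word (s # enumeration J))"
    by (simp add: sum_distrib_left gen_def const_def mult_single plus_list_def)
  moreover have "(\<Sum>J\<in>indep. const (c J) * word (s # enumeration J)) \<in> spanned"
    by (intro spanned_sum spanned_const spanned_gen_basis s)
  ultimately show ?thesis using spanned_eqv by blast
qed

lemma polys_spanned:
  assumes "p \<in> polys"
  shows "p \<in> spanned"
proof -
  have w: "word w \<in> spanned" if "w \<in> lists S" for w
    using that
  proof (induction w)
    case Nil
    have "enumeration ({} :: 's set) = []" using enumeration(1)[of "{} :: 's set"] by simp
    then show ?case using spanned_basis[of "{}"] by (simp add: indep_iff)
  next
    case (Cons s w)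
    then show ?case using spanned_gen[of s "word w"] by (simp add: gen_word word_mult)
  qed
  have "Poly_Mapping.keys p \<subseteq> lists S" using assms by simp
  then show ?thesis
  proof (induction p rule: free_algebra_induct)
    case (word u c)
    then show ?case using spanned_const[OF w[of u], of c] by (simp add: const_mult_word)
  qed (simp_all add: spanned_0 spanned_add)
qed

end

section \<open>The dimension\<close>

context commutative_hecke
begin

text \<open>Nontriviality of the quotient, without which the image of the constants would not be a
  field.\<close>

lemma one_notin_hecke_ideal: "1 \<notin> hecke_ideal S m q"
proof
  assume "1 \<in> hecke_ideal S m q"
  from sets.act_hecke_ideal[OF this, of vacuum] have "vacuum {} = 0" by simp
  then show False by (simp add: vacuum_def)
qed

section \<open>Cosets, the field of scalars and linear combinations\<close>

abbreviation coset :: "('s list \<Rightarrow>\<^sub>0 'f) \<Rightarrow> ('s list \<Rightarrow>\<^sub>0 'f) set" where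
  "coset p \<equiv> hecke_ideal S m q +>\<^bsub>free_algebra S\<^esub> p"

lemma coset_hom: "ring_hom_ring (free_algebra S) (hecke_algebra S m q) coset"
  unfolding hecke_algebra_def by (rule ideal.rcos_ring_hom_ring[OF hecke_ideal_ideal])

lemma coset_mult: "p \<in> polys \<Longrightarrow> r \<in> polys \<Longrightarrow> coset p \<otimes>\<^bsub>hecke_algebra S m q\<^esub> coset r = coset (p * r)"
  and coset_add: "p \<in> polys \<Longrightarrow> r \<in> polys \<Longrightarrow> coset p \<oplus>\<^bsub>hecke_algebra S m q\<^esub> coset r = coset (p + r)"
  and coset_one: "\<one>\<^bsub>hecke_algebra S m q\<^esub> = coset 1"
  and coset_zero: "\<zero>\<^bsub>hecke_algebra S m q\<^esub> = coset 0"
  and coset_closed: "p \<in> polys \<Longrightarrow> coset p \<in> carrier (hecke_algebra S m q)"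
proof -
  interpret h: ring_hom_ring "free_algebra S" "hecke_algebra S m q" coset by (rule coset_hom)
  show "p \<in> polys \<Longrightarrow> r \<in> polys \<Longrightarrow> coset p \<otimes>\<^bsub>hecke_algebra S m q\<^esub> coset r = coset (p * r)"
    using h.hom_mult[of p r] by simp
  show "p \<in> polys \<Longrightarrow> r \<in> polys \<Longrightarrow> coset p \<oplus>\<^bsub>hecke_algebra S m q\<^esub> coset r = coset (p + r)"
    using h.hom_add[of p r] by simp
  show "\<one>\<^bsub>hecke_algebra S m q\<^esub> = coset 1" using h.hom_one by simp
  show "\<zero>\<^bsub>hecke_algebra S m q\<^esub> = coset 0" using h.hom_zero by simp
  show "p \<in> polys \<Longrightarrow> coset p \<in> carrier (hecke_algebra S m q)" by (rule h.hom_closed)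
qed

lemma coset_eq_iff: "p \<in> polys \<Longrightarrow> r \<in> polys \<Longrightarrow> coset p = coset r \<longleftrightarrow> p \<asymp> r"
  unfolding eqv_def by (rule hecke_coset_eq)

lemma coset_surj: "carrier (hecke_algebra S m q) = coset ` polys"
  unfolding hecke_algebra_def FactRing_def partial_object.simps A_RCOSETS_def' by blast

lemma subfield_constants: "subfield (range const) (free_algebra S :: ('s list \<Rightarrow>\<^sub>0 'f) ring)"
proof -
  let ?R = "free_algebra S :: ('s list \<Rightarrow>\<^sub>0 'f) ring" and ?K = "range const :: ('s list \<Rightarrow>\<^sub>0 'f) set"
  interpret ring ?R by (rule ring_free_algebra)
  have minus: "\<ominus>\<^bsub>?R\<^esub> const c = const (- c)" for c :: 'f
  proof (rule minus_equality)
    show "const (- c) \<oplus>\<^bsub>?R\<^esub> const c = \<zero>\<^bsub>?R\<^esub>"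
      by (simp add: const_0 flip: const_add)
  qed (rule polys_const)+
  have nz: "const c \<noteq> (0 :: 's list \<Rightarrow>\<^sub>0 'f)" if "c \<noteq> 0" for c
    using that unfolding const_def by (metis lookup_single_eq lookup_zero)
  have "subcring ?K ?R"
  proof (rule subcringI)
    show "subring ?K ?R"
    proof (rule subringI)
      show "?K \<subseteq> carrier ?R" using polys_const by blast
    qed (auto simp: minus simp flip: const_1 const_mult const_add)
  qed (auto simp: mult.commute simp flip: const_mult)
  moreover have "Units (?R\<lparr>carrier := ?K\<rparr>) = ?K - {\<zero>\<^bsub>?R\<^esub>}"
  proof
    show "Units (?R\<lparr>carrier := ?K\<rparr>) \<subseteq> ?K - {\<zero>\<^bsub>?R\<^esub>}"
      by (auto simp: Units_def)
    show "?K - {\<zero>\<^bsub>?R\<^esub>} \<subseteq> Units (?R\<lparr>carrier := ?K\<rparr>)"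
    proof
      fix x assume "x \<in> ?K - {\<zero>\<^bsub>?R\<^esub>}"
      then obtain c where "x = const c" "x \<noteq> 0" by auto
      then have c: "x = const c" "c \<noteq> 0" by (auto simp: const_0)
      then have "const (inverse c) * x = 1" "x * const (inverse c) = 1"
        by (simp_all add: const_1 flip: const_mult)
      with c show "x \<in> Units (?R\<lparr>carrier := ?K\<rparr>)" by (auto simp: Units_def)
    qed
  qed
  ultimately show ?thesis by (rule subfieldI)
qed

lemma hecke_scalars_eq: "hecke_scalars S m q = coset ` range const"
  by (auto simp: hecke_scalars_def)

lemma subfield_hecke_scalars: "subfield (hecke_scalars S m q) (hecke_algebra S m q)"
proof -
  interpret h: ring_hom_ring "free_algebra S" "hecke_algebra S m q" coset by (rule coset_hom)
  have "coset 1 \<noteq> coset 0"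
    using coset_eq_iff[OF polys_1 polys_0] one_notin_hecke_ideal by (simp add: eqv_def)
  then show ?thesis
    unfolding hecke_scalars_eq by (intro h.img_is_subfield subfield_constants) (simp add: coset_one coset_zero)
qed

lemma combine_cosets:
  assumes "distinct Js" "set Js \<subseteq> indep"
  shows "ring.combine (hecke_algebra S m q) (map (\<lambda>J. coset (const (c J))) Js) (map (\<lambda>J. coset (word (enumeration J))) Js)
    = coset (\<Sum>J\<in>set Js. const (c J) * word (enumeration J))"
proof -
  interpret ring "hecke_algebra S m q" using commutative by (rule cring.axioms(1))
  show ?thesis
    using assms
  proof (induction Js)
    case Nil
    show ?case by (simp add: coset_zero)
  next
    case (Cons J Js)
    have w: "const (c L) * word (enumeration L) \<in> polys" if "L \<in> indep" for L
      by (intro polys_mult polys_const polys_word enumeration_lists that)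
    then have "(\<Sum>L\<in>set Js. const (c L) * word (enumeration L)) \<in> polys"
      using Cons.prems by (intro polys_sum) auto
    moreover have "word (enumeration J) \<in> polys"
      using Cons.prems by (intro polys_word enumeration_lists) simp
    ultimately show ?case
      using Cons w[of J] by (simp add: coset_mult[OF polys_const] coset_add del: free_algebra_simps)
  qed
qed

lemma hecke_dimension_indep: "hecke_dimension S m q (card indep)"
proof -
  interpret H: ring "hecke_algebra S m q" using commutative by (rule cring.axioms(1))
  let ?K = "hecke_scalars S m q"
  obtain Js where Js: "set Js = indep" "distinct Js"
    using finite_distinct_list[OF finite_indep] by blast
  define Us where "Us = map (\<lambda>J. coset (word (enumeration J))) Js"
  have basis: "word (enumeration J) \<in> polys" if "J \<in> indep" for J
    by (intro polys_word enumeration_lists that)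
  then have Us: "set Us \<subseteq> carrier (hecke_algebra S m q)"
    using Js(1) coset_closed by (auto simp: Us_def simp del: free_algebra_simps)
  have lc: "(\<Sum>J\<in>indep. const (c J) * word (enumeration J)) \<in> polys" for c
    by (intro polys_sum polys_mult polys_const basis)
  have combine: "H.combine (map (\<lambda>J. coset (const (c J))) Js) Us = coset (\<Sum>J\<in>indep. const (c J) * word (enumeration J))" for c
    using combine_cosets[OF Js(2), of c] Js(1) by (simp add: Us_def)
  have scalars: "\<exists>c. Ks = map (\<lambda>J. coset (const (c J))) Js" if "set Ks \<subseteq> ?K" "length Ks = length Js" for Ks
  proof -
    have "\<exists>d. Ks = map (coset \<circ> const) d" using that(1)
      by (metis (no_types, lifting) hecke_scalars_def comp_apply ex_map_conv rangeE subsetD)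
    then obtain d where d: "Ks = map (coset \<circ> const) d" by blast
    \<comment> \<open>A list of scalars becomes a function on sets through the position of
      \<open>J\<close> in the distinct list \<open>Js\<close>.\<close>
    define c where "c J = d ! (THE i. i < length Js \<and> Js ! i = J)" for J
    have "c (Js ! i) = d ! i" if "i < length Js" for i
    proof -
      have "(THE j. j < length Js \<and> Js ! j = Js ! i) = i"
        using that Js(2) by (intro the_equality) (auto simp: nth_eq_iff_index_eq)
      then show ?thesis by (simp add: c_def)
    qed
    then have "Ks = map (\<lambda>J. coset (const (c J))) Js"
      using that(2) d by (intro nth_equalityI) simp_all
    then show ?thesis by blast
  qed
  have sub: "subfield ?K (hecke_algebra S m q)" by (rule subfield_hecke_scalars)
  have "H.independent ?K Us"
  proof (rule H.trivial_combine_imp_independent[OF sub Us])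
    fix Ks assume Ks: "set Ks \<subseteq> ?K" "H.combine Ks Us = \<zero>\<^bsub>hecke_algebra S m q\<^esub>"
    let ?Z = "\<zero>\<^bsub>hecke_algebra S m q\<^esub>"
    \<comment> \<open>\<open>combine\<close> stops at the shorter of its lists, so a relation of
      arbitrary length is truncated or padded with zeros to the length of \<open>Us\<close>.\<close>
    define L where "L = take (length Us) Ks @ replicate (length Us - length Ks) ?Z"
    have Z: "?Z \<in> ?K" using coset_zero by (auto simp: hecke_scalars_def const_0[symmetric])
    have "set L \<subseteq> ?K" using Ks(1) Z by (auto simp: L_def dest: in_set_takeD)
    moreover have "length L = length Js" by (simp add: L_def Us_def)
    ultimately obtain c where c: "L = map (\<lambda>J. coset (const (c J))) Js" using scalars by blast
    have "H.combine L Us = ?Z"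
    proof (cases "length Ks \<le> length Us")
      case True
      then show ?thesis
        using H.combine_append_replicate[OF Us, of Ks "length Us - length Ks"] Ks(2) by (simp add: L_def)
    next
      case False
      then show ?thesis using H.combine_take[of Us Ks] Ks(2) by (simp add: L_def)
    qed
    then have "(\<Sum>J\<in>indep. const (c J) * word (enumeration J)) \<asymp> 0"
      using combine[of c] c coset_eq_iff[OF lc polys_0, of c] by (simp add: coset_zero)
    then have "c J = 0" if "J \<in> indep" for J
      using indep_words_independent[OF _ that, of c] by (simp add: eqv_def)
    then have "set L \<subseteq> {?Z}" using c Js(1) by (auto simp: coset_zero const_0)
    then show "set (take (length Us) Ks) \<subseteq> {?Z}" by (auto simp: L_def)
  qed
  then have "H.dimension (length Us) ?K (H.Span ?K Us)"
    by (rule H.dimension_independent)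
  moreover have "H.Span ?K Us = carrier (hecke_algebra S m q)"
  proof
    show "H.Span ?K Us \<subseteq> carrier (hecke_algebra S m q)"
      using H.Span_in_carrier[OF subfieldE(3)[OF sub] Us] .
    show "carrier (hecke_algebra S m q) \<subseteq> H.Span ?K Us"
    proof
      fix x assume "x \<in> carrier (hecke_algebra S m q)"
      then obtain p where p: "p \<in> polys" "x = coset p" unfolding coset_surj by blast
      from polys_spanned[OF p(1)] obtain c where "p \<asymp> (\<Sum>J\<in>indep. const (c J) * word (enumeration J))"
        by (auto simp: spanned_def)
      then have "x = H.combine (map (\<lambda>J. coset (const (c J))) Js) Us"
        unfolding combine p(2) coset_eq_iff[OF p(1) lc] .
      then show "x \<in> H.Span ?K Us"
        unfolding H.Span_eq_combine_set[OF sub Us]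
        by (intro CollectI exI[of _ "map (\<lambda>J. coset (const (c J))) Js"]) (auto simp: hecke_scalars_def)
    qed
  qed
  moreover have "length Us = card indep"
    using Js distinct_card[of Js] by (simp add: Us_def)
  ultimately show ?thesis by (simp add: hecke_dimension_def)
qed

end

section \<open>Independent sets of a path\<close>

definition sparse_sets :: "nat \<Rightarrow> nat set set" where
  "sparse_sets n = {I. I \<subseteq> {1..n} \<and> (\<forall>i. \<not> (i \<in> I \<and> Suc i \<in> I))}"

text \<open>A set containing the last vertex must avoid its predecessor, which gives the Fibonacci
  recursion.\<close>

lemma sparse_sets_Suc_Suc:
  "sparse_sets (Suc (Suc n)) = sparse_sets (Suc n) \<union> insert (Suc (Suc n)) ` sparse_sets n"
proof
  show "sparse_sets (Suc (Suc n)) \<subseteq> sparse_sets (Suc n) \<union> insert (Suc (Suc n)) ` sparse_sets n"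
  proof
    fix I assume I: "I \<in> sparse_sets (Suc (Suc n))"
    show "I \<in> sparse_sets (Suc n) \<union> insert (Suc (Suc n)) ` sparse_sets n"
    proof (cases "Suc (Suc n) \<in> I")
      case True
      then have "Suc n \<notin> I" using I by (auto simp: sparse_sets_def)
      have "I - {Suc (Suc n)} \<subseteq> {1..n}"
      proof
        fix i assume i: "i \<in> I - {Suc (Suc n)}"
        then have "i \<noteq> Suc n" using \<open>Suc n \<notin> I\<close> by auto
        with i I show "i \<in> {1..n}" by (force simp: sparse_sets_def)
      qed
      then have "I - {Suc (Suc n)} \<in> sparse_sets n" using I by (auto simp: sparse_sets_def)
      moreover have "I = insert (Suc (Suc n)) (I - {Suc (Suc n)})" using True by blast
      ultimately show ?thesis by blast
    next
      case False
      then have "I \<subseteq> {1..Suc n}" using I unfolding sparse_sets_def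
        by (auto simp: subset_iff) (metis le_SucE)
      then show ?thesis using I by (simp add: sparse_sets_def)
    qed
  qed
  show "sparse_sets (Suc n) \<union> insert (Suc (Suc n)) ` sparse_sets n \<subseteq> sparse_sets (Suc (Suc n))"
  proof (intro Un_least subsetI)
    fix I assume "I \<in> sparse_sets (Suc n)"
    then show "I \<in> sparse_sets (Suc (Suc n))" by (auto simp: sparse_sets_def)
  next
    fix I assume "I \<in> insert (Suc (Suc n)) ` sparse_sets n"
    then obtain J where I: "I = insert (Suc (Suc n)) J" and J: "J \<subseteq> {1..n}"
      and sparse: "\<And>i. \<not> (i \<in> J \<and> Suc i \<in> J)" by (auto simp: sparse_sets_def)
    have "Suc n \<notin> J" "Suc (Suc (Suc n)) \<notin> J" using J by auto
    then have "\<not> (i \<in> I \<and> Suc i \<in> I)" for i using sparse[of i] unfolding I by auto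
    moreover have "I \<subseteq> {1..Suc (Suc n)}" using J by (auto simp: I)
    ultimately show "I \<in> sparse_sets (Suc (Suc n))" by (simp add: sparse_sets_def)
  qed
qed

lemma card_sparse_sets: "card (sparse_sets n) = fib (n + 2)"
proof (induction n rule: induct_nat_012)
  case 0
  have "sparse_sets 0 = {{}}" by (auto simp: sparse_sets_def)
  then show ?case by simp
next
  case 1
  have "sparse_sets 1 = {{}, {1}}" by (auto simp: sparse_sets_def)
  then show ?case by (simp add: numeral_eq_Suc)
next
  case (ge2 n)
  have fin: "finite (sparse_sets n)" for n
    by (rule finite_subset[of _ "Pow {1..n}"]) (auto simp: sparse_sets_def)
  have notin: "Suc (Suc n) \<notin> I" if "I \<in> sparse_sets n \<union> sparse_sets (Suc n)" for I
    using that by (force simp: sparse_sets_def)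
  have "inj_on (insert (Suc (Suc n))) (sparse_sets n)"
    using notin by (intro inj_onI) (metis UnI1 insert_ident)
  moreover have "sparse_sets (Suc n) \<inter> insert (Suc (Suc n)) ` sparse_sets n = {}"
    using notin by blast
  ultimately show ?case
    using ge2 fin by (simp add: sparse_sets_Suc_Suc card_Un_disjoint card_image)
qed

lemma card_independent_sets_path:
  assumes v: "bij_betw v {1..n} S" and E: "E = {{v i, v (Suc i)} | i. 1 \<le> i \<and> i < n}"
  shows "card (independent_sets S E) = fib (n + 2)"
proof -
  have inj: "inj_on v {1..n}" and S: "S = v ` {1..n}" using v by (auto simp: bij_betw_def)
  have edge: "{v i, v j} \<in> E \<longleftrightarrow> j = Suc i \<or> i = Suc j" if "i \<in> {1..n}" "j \<in> {1..n}" for i j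
  proof
    assume "{v i, v j} \<in> E"
    then obtain l where l: "{v i, v j} = {v l, v (Suc l)}" "1 \<le> l" "l < n" by (auto simp: E)
    then have "l \<in> {1..n}" "Suc l \<in> {1..n}" by auto
    with l(1) that show "j = Suc i \<or> i = Suc j"
      using inj by (auto simp: doubleton_eq_iff inj_on_eq_iff)
  next
    assume "j = Suc i \<or> i = Suc j"
    then show "{v i, v j} \<in> E" using that by (auto simp: E insert_commute)
  qed
  have "independent_sets S E = image v ` sparse_sets n"
  proof (intro equalityI subsetI)
    fix I assume I: "I \<in> independent_sets S E"
    let ?J = "{i \<in> {1..n}. v i \<in> I}"
    have "I = v ` ?J" using I by (auto simp: independent_sets_def S)
    moreover have "?J \<in> sparse_sets n"
      unfolding sparse_sets_def
    proof (intro CollectI conjI allI notI)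
      fix i assume i: "i \<in> ?J \<and> Suc i \<in> ?J"
      \<comment> \<open>\<open>pairwise\<close> constrains only distinct elements, so injectivity
        comes in before the edge can be excluded.\<close>
      then have "v i \<noteq> v (Suc i)" using inj_on_eq_iff[OF inj, of i "Suc i"] by simp
      then show False
        using i I edge[of i "Suc i"] by (auto simp: independent_sets_def pairwise_def)
    qed auto
    ultimately show "I \<in> image v ` sparse_sets n" by blast
  next
    fix I assume "I \<in> image v ` sparse_sets n"
    then obtain J where J: "J \<subseteq> {1..n}" "\<And>i. \<not> (i \<in> J \<and> Suc i \<in> J)" and I: "I = v ` J"
      by (auto simp: sparse_sets_def)
    have "{v i, v j} \<notin> E" if "i \<in> J" "j \<in> J" for i j
      using edge[of i j] J that by blast
    then show "I \<in> independent_sets S E"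
      using J(1) by (auto simp: independent_sets_def pairwise_def I S)
  qed
  moreover have "inj_on (image v) (sparse_sets n)"
    by (rule inj_on_subset[OF inj_on_image_Pow[OF inj]]) (auto simp: sparse_sets_def)
  ultimately show ?thesis by (simp add: card_image card_sparse_sets)
qed

theorem corollary1p5:
  fixes W :: "('s, 'b) monoid_scheme" and S :: "'s set" and m :: "'s \<Rightarrow> 's \<Rightarrow> enat"
    and q :: "'s \<Rightarrow> 'f::field"
  assumes "coxeter_system W S m"
    and "collapse_free S m q"
    and "cring (hecke_algebra S m q)"
  shows "hecke_dimension S m q (card (independent_sets S (diagram_edges S m)))
    \<and> (\<forall>n. type_A n S m \<longrightarrow> hecke_dimension S m q (fib (n + 2)))"
proof -
  have m: "m u w = m w u \<and> 2 \<le> m u w" if "u \<in> S" "w \<in> S" "u \<noteq> w" for u w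
  proof -
    have "\<forall>s\<in>S. \<forall>t\<in>S. s \<noteq> t \<longrightarrow> m s t = m t s \<and> 2 \<le> m s t"
      using assms(1) unfolding coxeter_system_def by (elim conjE)
    from this[rule_format, OF that] show ?thesis .
  qed
  interpret commutative_hecke S m q
  proof (rule commutative_hecke.intro[OF _ conjunct1[OF m] conjunct2[OF m] assms(2,3)])
    show "finite S" using assms(1) unfolding coxeter_system_def by (elim conjE)
  qed
  have card: "card indep = fib (n + 2)" if "type_A n S m" for n
  proof -
    from that obtain v where "bij_betw v {1..n} S"
      "diagram_edges S m = {{v i, v (Suc i)} | i. 1 \<le> i \<and> i < n}"
      unfolding type_A_def by (elim conjE exE)
    then show ?thesis by (rule card_independent_sets_path)
  qed
  show ?thesis
  proof (intro conjI allI impI)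
    show "hecke_dimension S m q (fib (n + 2))" if "type_A n S m" for n
      using hecke_dimension_indep unfolding card[OF that] .
  qed (rule hecke_dimension_indep)
qed

end
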